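(* Let $H\in\mathbb{R}^{2n\times 2n}$ be a nonsingular Hamiltonian matrix. Let $r\ge 1$, $s\ge 0$ be integers with $r+s=n$ and either $r=s+1$ or $r=s$. Let $u_1\in\mathbb{R}^{2n}$ with $\|u_1\|_2=1$, and assume $\dim\mathcal{K}_{2r}(H,u_1)=2r$ and $\dim\mathcal{K}_{2s}(H^{-1},H^{-1}u_1)=2s$. Suppose that the HEKS procedure (described in the context) started with $u_1$ does not break down up to the construction of $S_{r+s}$. Then there exists a symplectic matrix $S\in\mathbb{R}^{2n\times 2n}$ such that $Se_{s+1}=u_1$, $$\operatorname{range}\{S\}=\mathcal{K}_{2r}(H,u_1)+\mathcal{K}_{2s}(H^{-1},H^{-1}u_1),$$ and $$S^{-1}HS=\begin{bmatrix}0&0&\Lambda_s&B_{sr}\\0&0&B_{sr}^T&T_r\\\Delta_s&0&0&0\\0&\Theta_r&0&0\end{bmatrix},$$ where the block rows and the block columns have sizes $s,r,s,r$, and $\Delta_s=\operatorname{diag}(\delta_s,\ldots,\delta_1)$, $\Lambda_s=\operatorname{diag}(\lambda_s,\ldots,\lambda_1)\in\mathbb{R}^{s\times s}$, $\Theta_r=\operatorname{diag}(\vartheta_1,\ldots,\vartheta_r)\in\mathbb{R}^{r\times r}$; $T_r\in\mathbb{R}^{r\times r}$ is the symmetric tridiagonal matrix with diagonal entries $\alpha_1,\ldots,\alpha_r$ and with entries $\beta_2,\ldots,\beta_r$ on the sub- and superdiagonal ($(T_r)_{j,j-1}=(T_r)_{j-1,j}=\beta_j$); and $B_{sr}\in\mathbb{R}^{s\times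 r}$ is the anti-bidiagonal matrix with entries $(B_{sr})_{s+1-j,\,j}=\gamma_j$ for $1\le j\le s$, $(B_{sr})_{s+2-j,\,j}=\mu_j$ for $2\le j\le r$, and all other entries zero. Here, writing the columns of $S$ as $S=[\,y_s\ \cdots\ y_1\ u_1\ \cdots\ u_r\mid x_s\ \cdots\ x_1\ v_1\ \cdots\ v_r\,]$, one has $\delta_j=y_j^TJ_nHy_j$, $\lambda_j=-x_j^TJ_nHx_j$ and $\gamma_j=-x_j^TJ_nHv_j$ for $1\le j\le s$, $\vartheta_j=u_j^TJ_nHu_j$ and $\alpha_j=-v_j^TJ_nHv_j$ for $1\le j\le r$, and $\beta_j=-v_j^TJ_nHv_{j-1}$ and $\mu_j=-x_{j-1}^TJ_nHv_j$ for $2\le j\le r$.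
   Context: Notation: $J_m=\begin{bmatrix}0&I_m\\-I_m&0\end{bmatrix}\in\mathbb{R}^{2m\times 2m}$. A matrix $H\in\mathbb{R}^{2n\times2n}$ is Hamiltonian if $J_nH=(J_nH)^T$. A matrix $S\in\mathbb{R}^{2n\times2n}$ is symplectic if $S^TJ_nS=J_n$. A matrix $S\in\mathbb{R}^{2n\times2m}$, $m\le n$, has $J$-orthogonal columns if $S^TJ_nS=J_m$. $\mathcal{K}_m(A,b)=\operatorname{span}\{b,Ab,\ldots,A^{m-1}b\}$ (with $\mathcal{K}_0=\{0\}$), $\operatorname{range}$ is the column span, and $e_i$ is the $i$-th standard unit vector. HEKS procedure. Given $u_1$ with $\|u_1\|_2=1$, matrices $S_1,S_2,\ldots,S_{r+s}$ are built, where $S_m\in\mathbb{R}^{2n\times 2m}$ and $S_{2k}=[\,y_k\ \cdots\ y_1\ u_1\ \cdots\ u_k\mid x_k\ \cdots\ x_1\ v_1\ \cdots\ v_k\,]$, $S_{2k+1}=[\,y_k\ \cdots\ y_1\ u_1\ \cdots\ u_{k+1}\mid x_k\ \cdots\ x_1\ v_1\ \cdots\ v_{k+1}\,]$. Put $P_m=I-S_mJ_m^TS_m^TJ_n$ ($J$-orthogonalization against the columns of $S_m$). (1) $v_1=Hu_1/(u_1^TJ_nHu_1)$, which gives $S_1=[u_1\mid v_1]$. (2) From $S_1$ to $S_2$: $w_x=P_1H^{-1}u_1$, $x_1=w_x/\|w_x\|_2$, $w_y=P_1H^{-1}x_1$, $y_1=w_y/(w_y^TJ_nx_1)$. (3)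 From $S_{2k}$ to $S_{2k+1}$, $k\ge1$: $w_u=P_{2k}Hv_k$, $u_{k+1}=w_u/\|w_u\|_2$, $w_v=P_{2k}Hu_{k+1}$, $v_{k+1}=w_v/(u_{k+1}^TJ_nw_v)$. (4) From $S_{2k+1}$ to $S_{2k+2}$, $k\ge1$: $w_x=P_{2k+1}H^{-1}y_k$, $x_{k+1}=w_x/\|w_x\|_2$, $w_y=P_{2k+1}H^{-1}x_{k+1}$, $y_{k+1}=w_y/(w_y^TJ_nx_{k+1})$. The procedure does not break down if every number divided by in the steps needed to construct $S_{r+s}$ is nonzero. *)

theory Defs
  imports
    Complex_Main
    "Jordan_Normal_Form.Gauss_Jordan_Elimination"
    "Jordan_Normal_Form.VS_Connect"
begin

definition Jmat :: "nat \<Rightarrow> real mat" where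
  "Jmat m = four_block_mat (0\<^sub>m m m) (1\<^sub>m m) (- 1\<^sub>m m) (0\<^sub>m m m)"

definition hamiltonian :: "nat \<Rightarrow> real mat \<Rightarrow> bool" where
  "hamiltonian n H \<longleftrightarrow> H \<in> carrier_mat (2*n) (2*n) \<and> Jmat n * H = (Jmat n * H)\<^sup>T"

definition symplectic :: "nat \<Rightarrow> real mat \<Rightarrow> bool" where
  "symplectic n S \<longleftrightarrow> S \<in> carrier_mat (2*n) (2*n) \<and> S\<^sup>T * Jmat n * S = Jmat n"

definition norm2 :: "real vec \<Rightarrow> real" where
  "norm2 w = sqrt (w \<bullet> w)"

text \<open>\<open>Jform n a b\<close> is \<open>a\<^sup>T J b\<close>.\<close>
definition Jform :: "nat \<Rightarrow> real vec \<Rightarrow> real vec \<Rightarrow> real" where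
  "Jform n a b = a \<bullet> (Jmat n *\<^sub>v b)"

text \<open>Only meaningful for invertible square matrices, see \<open>minv_inverse\<close>.\<close>
definition minv :: "real mat \<Rightarrow> real mat" where
  "minv A = the (mat_inverse A)"

lemma minv_inverse:
  assumes A: "A \<in> carrier_mat n n" and inv: "invertible_mat A"
  shows "minv A \<in> carrier_mat n n" "A * minv A = 1\<^sub>m n" "minv A * A = 1\<^sub>m n"
proof -
  from inv obtain B where AB: "A * B = 1\<^sub>m n" and BA: "B * A = 1\<^sub>m (dim_row B)"
    unfolding invertible_mat_def inverts_mat_def using A by auto
  have "dim_col B = n" using arg_cong[OF AB, of dim_col] by simp
  moreover have "dim_row B = n" using arg_cong[OF BA, of dim_col] A by simp
  ultimately have B: "B \<in> carrier_mat n n" by auto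
  hence "A \<in> Units (ring_mat TYPE(real) n ())"
    unfolding Units_def using A AB BA by (auto simp: ring_mat_simps)
  with mat_inverse(1)[OF A, where b = "()"] obtain C where C: "mat_inverse A = Some C"
    by (cases "mat_inverse A") auto
  with mat_inverse(2)[OF A C]
  show "minv A \<in> carrier_mat n n" "A * minv A = 1\<^sub>m n" "minv A * A = 1\<^sub>m n"
    by (auto simp: minv_def)
qed

context vec_space
begin

definition krylov :: "nat \<Rightarrow> 'a mat \<Rightarrow> 'a vec \<Rightarrow> 'a vec set" where
  "krylov m A b = span {(A ^\<^sub>m k) *\<^sub>v b | k. k < m}"

definition subspace_dim :: "'a vec set \<Rightarrow> nat" where
  "subspace_dim W = vectorspace.dim class_ring (vs W)"

definition sum_of_subspaces :: "'a vec set \<Rightarrow> 'a vec set \<Rightarrow> 'a vec set" where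
  "sum_of_subspaces U W = subspace_sum U W"

end

text \<open>
  The matrices \<open>S\<^sub>m\<close> are kept as four lists of columns, in the order in which the columns occur in
  the matrix: \<open>ys = [y\<^sub>k, \<dots>, y\<^sub>1]\<close>, \<open>us = [u\<^sub>1, \<dots>, u\<^sub>l]\<close>, \<open>xs = [x\<^sub>k, \<dots>, x\<^sub>1]\<close>,
  \<open>vs = [v\<^sub>1, \<dots>, v\<^sub>l]\<close>. So the newest \<open>y\<close> and \<open>x\<close> come first, the newest \<open>u\<close> and \<open>v\<close> last.
\<close>
definition heks_mat ::
  "nat \<Rightarrow> real vec list \<Rightarrow> real vec list \<Rightarrow> real vec list \<Rightarrow> real vec list \<Rightarrow> real mat" where
  "heks_mat n ys us xs vs = mat_of_cols (2*n) (ys @ us @ xs @ vs)"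

definition J_proj :: "nat \<Rightarrow> nat \<Rightarrow> real mat \<Rightarrow> real mat" where
  "J_proj n m S = 1\<^sub>m (2*n) - S * (Jmat m)\<^sup>T * S\<^sup>T * Jmat n"

text \<open>
  \<open>heks n H u1 m ys us xs vs\<close>: the procedure started with \<open>u1\<close> reaches \<open>S\<^sub>m\<close> without dividing by
  zero, and \<open>S\<^sub>m = heks_mat n ys us xs vs\<close>. The four rules are the steps of the procedure, and the
  premises of the form \<open>\<dots> \<noteq> 0\<close> concern exactly the numbers divided by in that step.
\<close>
inductive heks ::
  "nat \<Rightarrow> real mat \<Rightarrow> real vec \<Rightarrow> nat \<Rightarrow>
   real vec list \<Rightarrow> real vec list \<Rightarrow> real vec list \<Rightarrow> real vec list \<Rightarrow> bool"
  for n :: nat and H :: "real mat" and u1 :: "real vec"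
where
  start:
    "d = Jform n u1 (H *\<^sub>v u1) \<Longrightarrow> d \<noteq> 0 \<Longrightarrow>
     v1 = (1 / d) \<cdot>\<^sub>v (H *\<^sub>v u1) \<Longrightarrow>
     heks n H u1 1 [] [u1] [] [v1]"
| first_xy:
    "heks n H u1 1 [] us [] vs \<Longrightarrow>
     P = J_proj n 1 (heks_mat n [] us [] vs) \<Longrightarrow>
     wx = P *\<^sub>v (minv H *\<^sub>v u1) \<Longrightarrow> norm2 wx \<noteq> 0 \<Longrightarrow>
     x = (1 / norm2 wx) \<cdot>\<^sub>v wx \<Longrightarrow>
     wy = P *\<^sub>v (minv H *\<^sub>v x) \<Longrightarrow> Jform n wy x \<noteq> 0 \<Longrightarrow>
     y = (1 / Jform n wy x) \<cdot>\<^sub>v wy \<Longrightarrow>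
     heks n H u1 2 [y] us [x] vs"
| next_uv:
    "heks n H u1 (2*k) ys us xs vs \<Longrightarrow> k \<ge> 1 \<Longrightarrow>
     P = J_proj n (2*k) (heks_mat n ys us xs vs) \<Longrightarrow>
     wu = P *\<^sub>v (H *\<^sub>v last vs) \<Longrightarrow> norm2 wu \<noteq> 0 \<Longrightarrow>
     u = (1 / norm2 wu) \<cdot>\<^sub>v wu \<Longrightarrow>
     wv = P *\<^sub>v (H *\<^sub>v u) \<Longrightarrow> Jform n u wv \<noteq> 0 \<Longrightarrow>
     v = (1 / Jform n u wv) \<cdot>\<^sub>v wv \<Longrightarrow>
     heks n H u1 (2*k + 1) ys (us @ [u]) xs (vs @ [v])"
| next_xy:
    "heks n H u1 (2*k + 1) ys us xs vs \<Longrightarrow> k \<ge> 1 \<Longrightarrow>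
     P = J_proj n (2*k + 1) (heks_mat n ys us xs vs) \<Longrightarrow>
     wx = P *\<^sub>v (minv H *\<^sub>v hd ys) \<Longrightarrow> norm2 wx \<noteq> 0 \<Longrightarrow>
     x = (1 / norm2 wx) \<cdot>\<^sub>v wx \<Longrightarrow>
     wy = P *\<^sub>v (minv H *\<^sub>v x) \<Longrightarrow> Jform n wy x \<noteq> 0 \<Longrightarrow>
     y = (1 / Jform n wy x) \<cdot>\<^sub>v wy \<Longrightarrow>
     heks n H u1 (2*k + 2) (y # ys) us (x # xs) vs"

definition heks_no_breakdown :: "nat \<Rightarrow> real mat \<Rightarrow> real vec \<Rightarrow> nat \<Rightarrow> bool" where
  "heks_no_breakdown n H u1 m \<longleftrightarrow> (\<exists>ys us xs vs. heks n H u1 m ys us xs vs)"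

text \<open>
  In the following matrices \<open>i\<close> and \<open>j\<close> are one-based row and column numbers, whereas matrix
  positions are zero-based in the library.
\<close>
definition mat1 :: "nat \<Rightarrow> nat \<Rightarrow> (nat \<Rightarrow> nat \<Rightarrow> real) \<Rightarrow> real mat" where
  "mat1 p q f = mat p q (\<lambda>(i, j). f (i + 1) (j + 1))"

text \<open>\<open>diag(d\<^sub>1, \<dots>, d\<^sub>m)\<close> and \<open>diag(d\<^sub>m, \<dots>, d\<^sub>1)\<close>\<close>
definition diag_asc :: "nat \<Rightarrow> (nat \<Rightarrow> real) \<Rightarrow> real mat" where
  "diag_asc m d = mat1 m m (\<lambda>i j. if i = j then d i else 0)"

definition diag_desc :: "nat \<Rightarrow> (nat \<Rightarrow> real) \<Rightarrow> real mat" where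
  "diag_desc m d = mat1 m m (\<lambda>i j. if i = j then d (m + 1 - i) else 0)"

definition sym_tridiag :: "nat \<Rightarrow> (nat \<Rightarrow> real) \<Rightarrow> (nat \<Rightarrow> real) \<Rightarrow> real mat" where
  "sym_tridiag r \<alpha> \<beta> = mat1 r r (\<lambda>i j.
     if i = j then \<alpha> j else if i = j + 1 then \<beta> i else if j = i + 1 then \<beta> j else 0)"

definition anti_bidiag :: "nat \<Rightarrow> nat \<Rightarrow> (nat \<Rightarrow> real) \<Rightarrow> (nat \<Rightarrow> real) \<Rightarrow> real mat" where
  "anti_bidiag s r \<gamma> \<mu> = mat1 s r (\<lambda>i j.
     if j \<le> s \<and> i = s + 1 - j then \<gamma> j else if 2 \<le> j \<and> i = s + 2 - j then \<mu> j else 0)"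

end

theory Submission
  imports Defs
begin

text \<open>
  Write \<open>\<omega>(a, b) = a\<^sup>T J b\<close> and number the column pairs in the order in which they are created:
  \<open>(a\<^sub>0, b\<^sub>0) = (u\<^sub>1, v\<^sub>1)\<close>, \<open>(a\<^sub>1, b\<^sub>1) = (y\<^sub>1, x\<^sub>1)\<close>, \<open>(a\<^sub>2, b\<^sub>2) = (u\<^sub>2, v\<^sub>2)\<close>, and so on. The
  matrices \<open>H\<close> and \<open>H\<^sup>-\<^sup>1\<close> are skew-adjoint for \<open>\<omega>\<close>. Let \<open>X\<^sub>e\<close> be the span of the pairs older
  than \<open>e\<close>. By the recurrences, \<open>H b\<^sub>s\<close> lies in \<open>X\<^sub>e\<close> plus the line of \<open>a\<^sub>e\<close> for every even
  \<open>e > s\<close>, and \<open>H\<^sup>-\<^sup>1 a\<^sub>s\<close> lies in \<open>X\<^sub>e\<close> plus the line of \<open>b\<^sub>e\<close> for every odd \<open>e > s\<close>. Hence in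
  the second half of every step the vector to be projected is already \<open>J\<close>-orthogonal to all older
  columns, so that \<open>H a\<^sub>t\<close> is a multiple of \<open>b\<^sub>t\<close> for all \<open>t\<close>. Moreover \<open>\<omega>(b\<^sub>s, H b\<^sub>t) = 0\<close>
  as soon as some even number lies strictly between \<open>s\<close> and \<open>t\<close>. As \<open>S\<close> is symplectic,
  \<open>S\<^sup>-\<^sup>1 H S = J\<^sup>T (S\<^sup>T J H S)\<close>, and these facts give its zero pattern. Finally, all columns of the
  invertible matrix \<open>S\<close> lie in the sum of the two Krylov spaces, so both sides of the range
  identity are the whole space.
\<close>

subsection \<open>The matrix J and its bilinear form\<close>

lemma index_Jmat:
  assumes "i < 2*m" "j < 2*m"
  shows "Jmat m $$ (i, j) = (if j = i + m then 1 else if i = j + m then -1 else 0)"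
  using assms unfolding Jmat_def by auto

lemma Jmat_carrier [simp]: "Jmat m \<in> carrier_mat (2*m) (2*m)"
  using four_block_carrier_mat[of "0\<^sub>m m m :: real mat" m m "0\<^sub>m m m" m m]
  unfolding Jmat_def by (simp add: mult_2)

lemma dim_Jmat [simp]: "dim_row (Jmat m) = 2*m" "dim_col (Jmat m) = 2*m"
  using carrier_matD[OF Jmat_carrier[of m]] by auto

lemma Jmat_mult_vec [simp]: "w \<in> carrier_vec (2*m) \<Longrightarrow> Jmat m *\<^sub>v w \<in> carrier_vec (2*m)"
  by (rule mult_mat_vec_carrier[OF Jmat_carrier])

lemma Jmat_transpose: "(Jmat m)\<^sup>T = - Jmat m"
  by (rule eq_matI) (auto simp: index_Jmat)

text \<open>Left multiplication by \<open>(Jmat m)\<^sup>T\<close> swaps the upper and the lower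
  half and negates the one that moves up. The indices \<open>i\<close> and \<open>m + i\<close> are
  the two halves in which the blocks of the transformed matrix are read off.\<close>

lemma Jmat_transpose_mult_index:
  assumes M: "M \<in> carrier_mat (2*m) k" and i: "i < m" and j: "j < k"
  shows "((Jmat m)\<^sup>T * M) $$ (i, j) = - M $$ (m + i, j)"
    and "((Jmat m)\<^sup>T * M) $$ (m + i, j) = M $$ (i, j)"
proof -
  have il: "i < 2*m" "m + i < 2*m"
    using i by auto
  have *: "((Jmat m)\<^sup>T * M) $$ (l, j) = (\<Sum>h<2*m. Jmat m $$ (h, l) * M $$ (h, j))"
    if "l < 2*m" for l
    using that M j by (auto simp: scalar_prod_def atLeast0LessThan intro!: sum.cong)
  have "((Jmat m)\<^sup>T * M) $$ (i, j) = (\<Sum>h<2*m. if h = m + i then - M $$ (m + i, j) else 0)"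
    unfolding *[OF il(1)] using i by (intro sum.cong) (auto simp: index_Jmat)
  also have "\<dots> = - M $$ (m + i, j)"
    using i by simp
  finally show "((Jmat m)\<^sup>T * M) $$ (i, j) = - M $$ (m + i, j)" .
  have "((Jmat m)\<^sup>T * M) $$ (m + i, j) = (\<Sum>h<2*m. if h = i then M $$ (i, j) else 0)"
    unfolding *[OF il(2)] using i by (intro sum.cong) (auto simp: index_Jmat)
  also have "\<dots> = M $$ (i, j)"
    using i by simp
  finally show "((Jmat m)\<^sup>T * M) $$ (m + i, j) = M $$ (i, j)" .
qed

lemma Jmat_inverse:
  shows "(Jmat m)\<^sup>T * Jmat m = 1\<^sub>m (2*m)" and "Jmat m * (Jmat m)\<^sup>T = 1\<^sub>m (2*m)"
proof -
  show "(Jmat m)\<^sup>T * Jmat m = 1\<^sub>m (2*m)"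
  proof (rule eq_matI)
    fix i j assume ij: "i < dim_row (1\<^sub>m (2*m) :: real mat)" "j < dim_col (1\<^sub>m (2*m) :: real mat)"
    show "((Jmat m)\<^sup>T * Jmat m) $$ (i, j) = 1\<^sub>m (2*m) $$ (i, j)"
    proof (cases "i < m")
      case True
      with ij show ?thesis
        by (subst Jmat_transpose_mult_index(1)[OF Jmat_carrier]) (auto simp: index_Jmat)
    next
      case False
      then obtain h where "i = m + h"
        using le_Suc_ex not_less by blast
      with ij show ?thesis
        by (simp only:, subst Jmat_transpose_mult_index(2)[OF Jmat_carrier])
          (auto simp: index_Jmat)
    qed
  qed simp_all
  from mat_mult_left_right_inverse[OF _ _ this] show "Jmat m * (Jmat m)\<^sup>T = 1\<^sub>m (2*m)"
    by simp
qed

text \<open>Serves for \<open>A = J\<close>, where the entries are values of the form on the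
  columns, and for \<open>A = J H\<close>, where they are the entries of the transformed matrix up
  to order and sign.\<close>

lemma Gram_index:
  fixes A :: "'a::comm_semiring_0 mat"
  assumes "S \<in> carrier_mat p q" "A \<in> carrier_mat p p" "i < q" "j < q"
  shows "(S\<^sup>T * A * S) $$ (i, j) = col S i \<bullet> (A *\<^sub>v col S j)"
proof -
  have "S\<^sup>T * A * S = S\<^sup>T * (A * S)"
    by (rule assoc_mult_mat) (use assms in auto)
  then show ?thesis
    using assms by (simp add: col_mult2[OF assms(2,1,4)])
qed

section \<open>Bilinearity and skew-symmetry of the form\<close>

lemma Jform_add_left:
  "\<lbrakk>a \<in> carrier_vec (2*n); b \<in> carrier_vec (2*n); c \<in> carrier_vec (2*n)\<rbrakk>
    \<Longrightarrow> Jform n (a + b) c = Jform n a c + Jform n b c"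
  unfolding Jform_def by (rule add_scalar_prod_distrib[of _ "2*n"]) auto

lemma Jform_smult_left:
  "\<lbrakk>a \<in> carrier_vec (2*n); c \<in> carrier_vec (2*n)\<rbrakk> \<Longrightarrow> Jform n (r \<cdot>\<^sub>v a) c = r * Jform n a c"
  unfolding Jform_def by (rule smult_scalar_prod_distrib[of _ "2*n"]) auto

lemma Jform_zero_left: "c \<in> carrier_vec (2*n) \<Longrightarrow> Jform n (0\<^sub>v (2*n)) c = 0"
  unfolding Jform_def by (rule scalar_prod_left_zero) auto

lemma Jform_skew:
  assumes a: "a \<in> carrier_vec (2*n)" and b: "b \<in> carrier_vec (2*n)"
  shows "Jform n a b = - Jform n b a"
proof -
  have "Jform n b a = ((Jmat n)\<^sup>T *\<^sub>v b) \<bullet> a"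
    unfolding Jform_def using transpose_vec_mult_scalar[OF Jmat_carrier a b] ..
  also have "(Jmat n)\<^sup>T *\<^sub>v b = - (Jmat n *\<^sub>v b)"
    unfolding Jmat_transpose using b by (intro eq_vecI) auto
  also have "- (Jmat n *\<^sub>v b) \<bullet> a = - ((Jmat n *\<^sub>v b) \<bullet> a)"
    using a by (subst scalar_prod_uminus_left) auto
  also have "(Jmat n *\<^sub>v b) \<bullet> a = Jform n a b"
    unfolding Jform_def by (rule comm_scalar_prod[of _ "2*n"]) (use a b in auto)
  finally show ?thesis
    by simp
qed

lemma Jform_self: "a \<in> carrier_vec (2*n) \<Longrightarrow> Jform n a a = 0"
  using Jform_skew[of a n a] by simp

lemma Jform_smult_right:
  "\<lbrakk>a \<in> carrier_vec (2*n); c \<in> carrier_vec (2*n)\<rbrakk> \<Longrightarrow> Jform n a (r \<cdot>\<^sub>v c) = r * Jform n a c"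
  using Jform_skew[of a n "r \<cdot>\<^sub>v c"] Jform_skew[of a n c] by (simp add: Jform_smult_left)

subsection \<open>Spans\<close>

context vec_space
begin

text \<open>The vectors satisfying \<open>P\<close> form a submodule, and the span is the least
  submodule containing \<open>A\<close>.\<close>

lemma span_induct_vec [consumes 2, case_names zero base add smult]:
  assumes w: "w \<in> span A" and A: "A \<subseteq> carrier_vec n"
    and zero: "P (0\<^sub>v n)"
    and base: "\<And>a. a \<in> A \<Longrightarrow> P a"
    and add: "\<And>a b. \<lbrakk>a \<in> carrier_vec n; b \<in> carrier_vec n; P a; P b\<rbrakk> \<Longrightarrow> P (a + b)"
    and smult: "\<And>c a. \<lbrakk>a \<in> carrier_vec n; P a\<rbrakk> \<Longrightarrow> P (c \<cdot>\<^sub>v a)"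
  shows "P w"
proof -
  have "submodule class_ring {v \<in> carrier_vec n. P v} V"
    by unfold_locales
      (auto simp: module_vec_simps zero add smult add_smult_distrib_vec smult_add_distrib_vec)
  from span_is_subset[OF _ this] w A base show ?thesis
    by blast
qed

lemma span_mono_span: "\<lbrakk>w \<in> span A; A \<subseteq> span B; B \<subseteq> carrier_vec n\<rbrakk> \<Longrightarrow> w \<in> span B"
  using span_subsetI by blast

lemma span_mono: "\<lbrakk>w \<in> span A; A \<subseteq> B\<rbrakk> \<Longrightarrow> w \<in> span B"
  using span_is_monotone by blast

lemma span_base: "\<lbrakk>w \<in> A; A \<subseteq> carrier_vec n\<rbrakk> \<Longrightarrow> w \<in> span A"
  using in_own_span by blast

text \<open>Shows that normalizing a new column does not change the spans in the
  recurrences.\<close>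

lemma span_smult_cancel:
  assumes "c \<noteq> 0" "A \<subseteq> carrier_vec n" "w \<in> carrier_vec n"
  shows "span (insert (c \<cdot>\<^sub>v w) A) = span (insert w A)"
proof -
  have w: "w = (1/c) \<cdot>\<^sub>v (c \<cdot>\<^sub>v w)"
    using assms by (simp add: smult_smult_assoc)
  have "c \<cdot>\<^sub>v w \<in> span (insert w A)"
    using assms by (intro smult_in_span span_base) auto
  moreover have "w \<in> span (insert (c \<cdot>\<^sub>v w) A)"
    using assms by (subst w, intro smult_in_span span_base) auto
  moreover have "A \<subseteq> span (insert v A)" if "v \<in> carrier_vec n" for v
    using assms that by (auto intro: span_base)
  ultimately show ?thesis
    using assms by (intro equalityI span_subsetI insert_subsetI) auto
qed

lemma span_mult_mat_vec:
  assumes w: "w \<in> span A" and A: "A \<subseteq> carrier_vec n" and M: "M \<in> carrier_mat n n"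
    and B: "B \<subseteq> carrier_vec n" and img: "\<And>a. a \<in> A \<Longrightarrow> M *\<^sub>v a \<in> span B"
  shows "M *\<^sub>v w \<in> span B"
  using w A
proof (induction rule: span_induct_vec)
  case zero
  have "M *\<^sub>v 0\<^sub>v n = 0\<^sub>v n"
    using M by (intro eq_vecI) auto
  then show ?case
    using B span_zero by simp
next
  case (add a b)
  then show ?case
    using span_add1[OF B] by (simp add: mult_add_distrib_mat_vec[OF M])
next
  case (smult c a)
  then show ?case
    using smult_in_span[OF B] by (simp add: mult_mat_vec[OF M])
qed (use img in auto)

lemma subspace_sum_span:
  assumes "A \<subseteq> carrier_vec n" "B \<subseteq> carrier_vec n"
  shows "sum_of_subspaces (span A) (span B) = span (A \<union> B)"
  using span_union_is_sum[of A B] assms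
  unfolding sum_of_subspaces_def by simp

end

subsection \<open>The block pattern\<close>

text \<open>
  Column \<open>i\<close> of either half of \<open>S\<^sub>m\<close> is the \<open>col_age k i\<close>-th pair to be created, where \<open>k\<close> is the
  number of \<open>y\<close>-columns: odd ages are \<open>y\<close>, \<open>x\<close> (newest first), even ages are \<open>u\<close>, \<open>v\<close>.
\<close>
definition col_age :: "nat \<Rightarrow> nat \<Rightarrow> nat" where
  "col_age k i = (if i < k then 2 * (k - i) - 1 else 2 * (i - k))"

lemma col_age_less: "i < m \<Longrightarrow> col_age (m div 2) i < m"
  unfolding col_age_def by auto

text \<open>The parity of an age tells whether the column is of type \<open>y\<close>,
  \<open>x\<close> or of type \<open>u\<close>, \<open>v\<close>, and within each type the age is
  strictly monotone in the position.\<close>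

lemma col_age_inj: "col_age k i = col_age k j \<longleftrightarrow> i = j"
proof
  have parity: "even (col_age k h) \<longleftrightarrow> k \<le> h" for h
    unfolding col_age_def by auto
  assume eq: "col_age k i = col_age k j"
  then have "k \<le> i \<longleftrightarrow> k \<le> j"
    using parity by metis
  then show "i = j"
    using eq unfolding col_age_def by (auto split: if_splits)
qed simp

text \<open>An injective map of a finite set into itself is onto.\<close>

lemma col_age_image: "col_age (m div 2) ` {..<m} = {..<m}"
proof (rule card_subset_eq)
  show "card (col_age (m div 2) ` {..<m}) = card {..<m}"
    by (rule card_image) (auto simp: inj_on_def col_age_inj)
qed (auto intro: col_age_less)

lemma four_block_mat_eqI:
  assumes dims: "A \<in> carrier_mat s s" "D \<in> carrier_mat r r"
    and A: "\<And>i j. \<lbrakk>i < s; j < s\<rbrakk> \<Longrightarrow> A $$ (i, j) = f i j"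
    and B: "\<And>i j. \<lbrakk>i < s; j < r\<rbrakk> \<Longrightarrow> B $$ (i, j) = f i (s + j)"
    and C: "\<And>i j. \<lbrakk>i < r; j < s\<rbrakk> \<Longrightarrow> C $$ (i, j) = f (s + i) j"
    and D: "\<And>i j. \<lbrakk>i < r; j < r\<rbrakk> \<Longrightarrow> D $$ (i, j) = f (s + i) (s + j)"
    and ij: "i < s + r" "j < s + r"
  shows "four_block_mat A B C D $$ (i, j) = f i j"
proof -
  have half: "h < s \<or> (\<exists>h'<r. h = s + h')" if "h < s + r" for h
    by (cases "h < s") (use that in \<open>auto intro!: exI[of _ "h - s"]\<close>)
  show ?thesis
    using half[OF ij(1)] half[OF ij(2)] dims
    by (elim disjE exE conjE) (simp_all add: A B C D)
qed

text \<open>Two ages with no even number strictly between them are equal, consecutive, or both even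
  with difference 2. Equal ages give the diagonals of the two diagonal blocks, consecutive ages give
  \<open>B\<close>, and even ages with difference 2 give the off-diagonal entries of the tridiagonal
  block. The offset \<open>N\<close> selects the second half of the columns, the \<open>x\<close>
  and \<open>v\<close>.\<close>

lemma heks_block_mat:
  fixes f :: "nat \<Rightarrow> nat \<Rightarrow> real"
  assumes sym: "\<And>i j. i < s + r \<Longrightarrow> j < s + r \<Longrightarrow> f (N + i) (N + j) = f (N + j) (N + i)"
    and zero: "\<And>i j e. \<lbrakk>i < s + r; j < s + r; even e; col_age s i < e; e < col_age s j\<rbrakk> \<Longrightarrow>
      f (N + i) (N + j) = 0"
    and rs: "r = s + 1 \<or> r = s"
    and ij: "i < s + r" "j < s + r"
  shows "four_block_mat
      (diag_desc s (\<lambda>j. f (N + s - j) (N + s - j)))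
      (anti_bidiag s r (\<lambda>j. f (N + s - j) (N + s + j - 1)) (\<lambda>j. f (N + s - (j - 1)) (N + s + j - 1)))
      (anti_bidiag s r (\<lambda>j. f (N + s - j) (N + s + j - 1)) (\<lambda>j. f (N + s - (j - 1)) (N + s + j - 1)))\<^sup>T
      (sym_tridiag r (\<lambda>j. f (N + s + j - 1) (N + s + j - 1)) (\<lambda>j. f (N + s + j - 1) (N + s + (j - 1) - 1)))
      $$ (i, j) = f (N + i) (N + j)"
    (is "four_block_mat ?L ?B ?Bt ?T $$ _ = _")
proof -
  have zero': "f (N + i) (N + j) = 0" "f (N + j) (N + i) = 0"
    if "i < s + r" "j < s + r" "even e" "col_age s i < e" "e < col_age s j" for i j e
    using zero[OF that] sym[OF that(1,2)] by simp_all
  have dims [simp]: "dim_row ?L = s" "dim_col ?L = s" "dim_row ?T = r" "dim_col ?T = r"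
    "dim_row ?B = s" "dim_col ?B = r"
    by (simp_all add: diag_desc_def anti_bidiag_def sym_tridiag_def mat1_def)
  have B: "?B $$ (i, j) = f (N + i) (N + (s + j))" if "i < s" "j < r" for i j
  proof -
    \<comment> \<open>Row \<open>i\<close> belongs to x_(s-i) and column \<open>j\<close> to
      v_(j+1). The first alternative is the \<gamma>-diagonal, the second the \<mu>-diagonal, and
      the last two lie outside the pattern.\<close>
    have "(i = s - 1 - j \<and> j < s) \<or> (i = s - j \<and> j \<ge> 1) \<or> j > s - i \<or> j + 1 < s - i"
      using that by arith
    then consider "i = s - 1 - j" "j < s" | "i = s - j" "j \<ge> 1" | "j > s - i" | "j + 1 < s - i"
      by blast
    then show ?thesis
    proof cases
      case 1
      then show ?thesis
        using that by (simp add: anti_bidiag_def mat1_def algebra_simps)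
    next
      case 2
      \<comment> \<open>By \<open>rs\<close>, \<open>j \<le> s\<close>, so \<open>s - j\<close> is
        not truncated.\<close>
      then have "N + s - j = N + i" "i + 1 \<noteq> s + 1 - (j + 1)" "i + 1 = s + 2 - (j + 1)"
        using that rs by auto
      then show ?thesis
        using that 2 by (simp add: anti_bidiag_def mat1_def algebra_simps)
    next
      case 3
      \<comment> \<open>The smaller age is \<open>2 * (s - i) - 1\<close>, the larger one
        \<open>2 * j\<close>. The separating number is the least even number above the smaller age,
        here and for all other vanishing entries.\<close>
      have "f (N + i) (N + (s + j)) = 0"
        by (rule zero'(1)[of i "s + j" "2 * (s - i)"]) (use that 3 in \<open>auto simp: col_age_def\<close>)
      then show ?thesis
        using that 3 by (auto simp: anti_bidiag_def mat1_def)
    next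
      case 4
      have "f (N + i) (N + (s + j)) = 0"
        by (rule zero'(2)[of "s + j" i "2 * (j + 1)"]) (use that 4 in \<open>auto simp: col_age_def\<close>)
      then show ?thesis
        using that 4 by (auto simp: anti_bidiag_def mat1_def)
    qed
  qed
  have L: "?L $$ (i, j) = f (N + i) (N + j)" if "i < s" "j < s" for i j
  proof (cases i j rule: linorder_cases)
    case less
    have "f (N + i) (N + j) = 0"
      by (rule zero'(2)[of j i "2 * (s - j)"]) (use that less in \<open>auto simp: col_age_def\<close>)
    then show ?thesis
      using that less by (simp add: diag_desc_def mat1_def)
  next
    case greater
    have "f (N + i) (N + j) = 0"
      by (rule zero'(1)[of i j "2 * (s - i)"]) (use that greater in \<open>auto simp: col_age_def\<close>)
    then show ?thesis
      using that greater by (simp add: diag_desc_def mat1_def)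
  next
    case equal
    then have "N + s - (s + 1 - (j + 1)) = N + j"
      using that by simp
    then show ?thesis
      using that equal by (simp add: diag_desc_def mat1_def)
  qed
  have T: "?T $$ (i, j) = f (N + (s + i)) (N + (s + j))" if "i < r" "j < r" for i j
  proof -
    consider "i = j" | "i = j + 1" | "j = i + 1" | "i + 1 < j" | "j + 1 < i"
      by atomize_elim arith
    then show ?thesis
    proof cases
      case 3
      then show ?thesis
        using that sym[of "s + i" "s + j"] by (simp add: sym_tridiag_def mat1_def algebra_simps)
    next
      case 4
      have "f (N + (s + i)) (N + (s + j)) = 0"
        by (rule zero'(1)[of _ _ "2 * (i + 1)"]) (use that 4 in \<open>auto simp: col_age_def\<close>)
      then show ?thesis
        using that 4 by (simp add: sym_tridiag_def mat1_def)
    next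
      case 5
      have "f (N + (s + i)) (N + (s + j)) = 0"
        by (rule zero'(2)[of _ _ "2 * (j + 1)"]) (use that 5 in \<open>auto simp: col_age_def\<close>)
      then show ?thesis
        using that 5 by (simp add: sym_tridiag_def mat1_def)
    qed (use that in \<open>simp_all add: sym_tridiag_def mat1_def algebra_simps\<close>)
  qed
  have Bt: "?B\<^sup>T $$ (i, j) = f (N + (s + i)) (N + j)" if "i < r" "j < s" for i j
  proof -
    have "?B\<^sup>T $$ (i, j) = ?B $$ (j, i)"
      by (rule index_transpose_mat) (simp_all add: that del: One_nat_def)
    then show ?thesis
      using B[of j i] sym[of j "s + i"] that by (simp del: One_nat_def)
  qed
  have carrier: "?L \<in> carrier_mat s s" "?T \<in> carrier_mat r r"
    by (rule carrier_matI; rule dims)+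
  show ?thesis
    by (rule four_block_mat_eqI[where s = s and r = r and f = "\<lambda>i j. f (N + i) (N + j)"
          and A = ?L and B = ?B and C = "?B\<^sup>T" and D = ?T and i = i and j = j])
      (fact carrier ij | erule (1) L | erule (1) B | erule (1) Bt | erule (1) T)+
qed

lemma heks_diag_block_mat:
  fixes f :: "nat \<Rightarrow> nat \<Rightarrow> real"
  assumes diag: "\<And>i j. i < s + r \<Longrightarrow> j < s + r \<Longrightarrow> i \<noteq> j \<Longrightarrow> f i j = 0"
    and ij: "i < s + r" "j < s + r"
  shows "four_block_mat (diag_desc s (\<lambda>j. f (s - j) (s - j))) (0\<^sub>m s r) (0\<^sub>m r s)
      (diag_asc r (\<lambda>j. f (s + j - 1) (s + j - 1))) $$ (i, j) = f i j"
proof (cases "i = j")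
  case True
  then show ?thesis
    using ij by (auto simp: diag_desc_def diag_asc_def mat1_def)
next
  case False
  then show ?thesis
    using ij diag[OF ij] by (auto simp: diag_desc_def diag_asc_def mat1_def)
qed

subsection \<open>Hamiltonian matrices and J-orthonormal pairs\<close>

locale hamiltonian_matrix =
  fixes n :: nat and H :: "real mat"
  assumes ham: "hamiltonian n H" and inv: "invertible_mat H"
begin

sublocale vec_space "TYPE(real)" "2*n" .

abbreviation Hi :: "real mat" where "Hi \<equiv> minv H"
abbreviation \<omega> :: "real vec \<Rightarrow> real vec \<Rightarrow> real" where "\<omega> \<equiv> Jform n"

lemma H_carrier: "H \<in> carrier_mat (2*n) (2*n)"
  using ham unfolding hamiltonian_def by blast

lemma Hi_carrier: "Hi \<in> carrier_mat (2*n) (2*n)"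
  by (rule minv_inverse(1)[OF H_carrier inv])

lemma H_vec [simp]: "w \<in> carrier_vec (2*n) \<Longrightarrow> H *\<^sub>v w \<in> carrier_vec (2*n)"
  and Hi_vec [simp]: "w \<in> carrier_vec (2*n) \<Longrightarrow> Hi *\<^sub>v w \<in> carrier_vec (2*n)"
  using mult_mat_vec_carrier[OF H_carrier] mult_mat_vec_carrier[OF Hi_carrier] by auto

lemma H_Hi [simp]: "w \<in> carrier_vec (2*n) \<Longrightarrow> H *\<^sub>v (Hi *\<^sub>v w) = w"
  and Hi_H [simp]: "w \<in> carrier_vec (2*n) \<Longrightarrow> Hi *\<^sub>v (H *\<^sub>v w) = w"
  using minv_inverse[OF H_carrier inv]
  by (simp_all flip: assoc_mult_mat_vec[OF H_carrier Hi_carrier]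
      assoc_mult_mat_vec[OF Hi_carrier H_carrier])

text \<open>Since \<open>J H\<close> is symmetric, \<open>\<omega> a (H *\<^sub>v b)\<close> is
  symmetric in \<open>a\<close> and \<open>b\<close>; skew-symmetry of \<omega> turns this into
  skew-adjointness of \<open>H\<close>.\<close>

lemma Jform_H_left:
  assumes a: "a \<in> carrier_vec (2*n)" and b: "b \<in> carrier_vec (2*n)"
  shows "\<omega> (H *\<^sub>v a) b = - \<omega> a (H *\<^sub>v b)"
proof -
  let ?K = "Jmat n * H"
  have K: "?K \<in> carrier_mat (2*n) (2*n)" and sym: "?K\<^sup>T = ?K"
    using ham mult_carrier_mat[OF Jmat_carrier H_carrier] unfolding hamiltonian_def by auto
  have K_vec: "?K *\<^sub>v w = Jmat n *\<^sub>v (H *\<^sub>v w)" if "w \<in> carrier_vec (2*n)" for w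
    using that by (rule assoc_mult_mat_vec[OF Jmat_carrier H_carrier])
  have "\<omega> b (H *\<^sub>v a) = (?K *\<^sub>v b) \<bullet> a"
    unfolding Jform_def K_vec[OF a, symmetric]
    by (subst transpose_vec_mult_scalar[OF K a b, symmetric]) (simp add: sym)
  also have "\<dots> = \<omega> a (H *\<^sub>v b)"
    unfolding Jform_def K_vec[OF b]
    by (rule comm_scalar_prod[of _ "2*n"]) (use a b in auto)
  finally show ?thesis
    using Jform_skew[of "H *\<^sub>v a" n b] a b by simp
qed

lemma Jform_H_commute:
  assumes "a \<in> carrier_vec (2*n)" "b \<in> carrier_vec (2*n)"
  shows "\<omega> a (H *\<^sub>v b) = \<omega> b (H *\<^sub>v a)"
  using assms Jform_H_left[OF assms] Jform_skew[of "H *\<^sub>v a" n b] by simp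

text \<open>This is the skew-adjointness of \<open>H\<close>, applied to
  \<open>Hi *\<^sub>v a\<close> and \<open>Hi *\<^sub>v b\<close>.\<close>

lemma Jform_Hi_left:
  assumes "a \<in> carrier_vec (2*n)" "b \<in> carrier_vec (2*n)"
  shows "\<omega> (Hi *\<^sub>v a) b = - \<omega> a (Hi *\<^sub>v b)"
  using Jform_H_left[of "Hi *\<^sub>v a" "Hi *\<^sub>v b"] assms by simp

lemma Jform_span:
  assumes w: "w \<in> span A" and A: "A \<subseteq> carrier_vec (2*n)" and z: "z \<in> carrier_vec (2*n)"
    and orth: "\<And>a. a \<in> A \<Longrightarrow> \<omega> a z = 0"
  shows "\<omega> w z = 0"
  using w A by (induction rule: span_induct_vec)
    (use z orth in \<open>simp_all add: Jform_zero_left Jform_add_left Jform_smult_left\<close>)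

text \<open>With the numbering by age, these are the columns of \<open>S\<^sub>m\<close>.\<close>
definition pairs :: "nat \<Rightarrow> (nat \<Rightarrow> real vec) \<Rightarrow> (nat \<Rightarrow> real vec) \<Rightarrow> real vec set" where
  "pairs m a b = a ` {..<m} \<union> b ` {..<m}"

text \<open>The condition \<open>S\<^sup>T J S = J\<close> for columns listed by age. Permuting both
  halves in the same way preserves it, so it transfers to the column order of the matrices.\<close>

definition J_orthonormal :: "nat \<Rightarrow> (nat \<Rightarrow> real vec) \<Rightarrow> (nat \<Rightarrow> real vec) \<Rightarrow> bool" where
  "J_orthonormal m a b \<longleftrightarrow>
     (\<forall>t<m. a t \<in> carrier_vec (2*n) \<and> b t \<in> carrier_vec (2*n)) \<and>
     (\<forall>s<m. \<forall>t<m. \<omega> (a s) (a t) = 0 \<and> \<omega> (b s) (b t) = 0 \<and>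
       \<omega> (a s) (b t) = (if s = t then 1 else 0))"

lemma J_orthonormalD:
  assumes "J_orthonormal m a b"
  shows "t < m \<Longrightarrow> a t \<in> carrier_vec (2*n)" "t < m \<Longrightarrow> b t \<in> carrier_vec (2*n)"
    "\<lbrakk>s < m; t < m\<rbrakk> \<Longrightarrow> \<omega> (a s) (a t) = 0" "\<lbrakk>s < m; t < m\<rbrakk> \<Longrightarrow> \<omega> (b s) (b t) = 0"
    "\<lbrakk>s < m; t < m\<rbrakk> \<Longrightarrow> \<omega> (a s) (b t) = (if s = t then 1 else 0)"
    "\<lbrakk>s < m; t < m\<rbrakk> \<Longrightarrow> \<omega> (b s) (a t) = (if s = t then -1 else 0)"
proof -
  show "\<omega> (b s) (a t) = (if s = t then -1 else 0)" if "s < m" "t < m"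
    using assms that Jform_skew[of "b s" n "a t"] unfolding J_orthonormal_def by auto
qed (use assms in \<open>auto simp: J_orthonormal_def\<close>)

lemma pairs_carrier: "J_orthonormal m a b \<Longrightarrow> e \<le> m \<Longrightarrow> pairs e a b \<subseteq> carrier_vec (2*n)"
  unfolding J_orthonormal_def pairs_def by auto

lemma pairs_Suc: "pairs (Suc m) a b = insert (a m) (insert (b m) (pairs m a b))"
  unfolding pairs_def lessThan_Suc by auto

lemma pairs_mono: "e \<le> m \<Longrightarrow> pairs e a b \<subseteq> pairs m a b"
  unfolding pairs_def by auto

lemma pairsI: "t < m \<Longrightarrow> a t \<in> pairs m a b" "t < m \<Longrightarrow> b t \<in> pairs m a b"
  unfolding pairs_def by auto

text \<open>Orthogonality to the older columns on one side suffices, and the new vectors are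
  orthogonal to themselves, because \<omega> is skew.\<close>

lemma J_orthonormal_Suc:
  assumes J: "J_orthonormal m a b"
    and am: "a m \<in> carrier_vec (2*n)" and bm: "b m \<in> carrier_vec (2*n)"
    and oa: "\<And>c. c \<in> pairs m a b \<Longrightarrow> \<omega> c (a m) = 0"
    and ob: "\<And>c. c \<in> pairs m a b \<Longrightarrow> \<omega> c (b m) = 0"
    and 1: "\<omega> (a m) (b m) = 1"
  shows "J_orthonormal (Suc m) a b"
proof -
  have oa': "\<omega> (a m) c = 0" and ob': "\<omega> (b m) c = 0" if "c \<in> pairs m a b" for c
    using oa[OF that] ob[OF that] Jform_skew[of "a m" n c] Jform_skew[of "b m" n c] am bm
      pairs_carrier[OF J order_refl] that by auto
  show ?thesis
    using assms oa' ob' Jform_self[of "a m"] Jform_self[of "b m"]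
    unfolding J_orthonormal_def by (auto simp: less_Suc_eq pairsI)
qed

text \<open>The abstract content of \<open>p = P\<^sub>m w\<close>.\<close>
definition J_projection ::
  "nat \<Rightarrow> (nat \<Rightarrow> real vec) \<Rightarrow> (nat \<Rightarrow> real vec) \<Rightarrow> real vec \<Rightarrow> real vec \<Rightarrow> bool" where
  "J_projection m a b w p \<longleftrightarrow>
     p \<in> carrier_vec (2*n) \<and> w \<in> span (insert p (pairs m a b)) \<and>
     p \<in> span (insert w (pairs m a b)) \<and> (\<forall>c \<in> pairs m a b. \<omega> c p = 0) \<and>
     ((\<forall>c \<in> pairs m a b. \<omega> c w = 0) \<longrightarrow> p = w)"

lemma J_projectionD:
  assumes "J_projection m a b w p"
  shows "p \<in> carrier_vec (2*n)" "w \<in> span (insert p (pairs m a b))"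
    "p \<in> span (insert w (pairs m a b))" "c \<in> pairs m a b \<Longrightarrow> \<omega> c p = 0"
    "(\<And>c. c \<in> pairs m a b \<Longrightarrow> \<omega> c w = 0) \<Longrightarrow> p = w"
  using assms unfolding J_projection_def by blast+

end

subsection \<open>Krylov spaces\<close>

text \<open>The recursion of matrix powers puts the new factor on the right; for Krylov generators
  it is wanted on the left.\<close>

lemma pow_mat_Suc_vec:
  assumes A: "A \<in> carrier_mat m m" and w: "w \<in> carrier_vec m"
  shows "(A ^\<^sub>m Suc k) *\<^sub>v w = A *\<^sub>v ((A ^\<^sub>m k) *\<^sub>v w)"
  using w
proof (induction k arbitrary: w)
  case (Suc k)
  note pow_carrier = pow_carrier_mat[OF A]
  have shift: "(A ^\<^sub>m Suc l) *\<^sub>v w = (A ^\<^sub>m l) *\<^sub>v (A *\<^sub>v w)" for l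
    using assoc_mult_mat_vec[OF pow_carrier A Suc.prems] by simp
  show ?case
    unfolding shift[of "Suc k"] Suc.IH[OF mult_mat_vec_carrier[OF A Suc.prems]] shift[of k] ..
qed (use A in auto)

locale heks_process = hamiltonian_matrix +
  fixes u1 :: "real vec"
  assumes u1 [simp]: "u1 \<in> carrier_vec (2*n)"
begin

text \<open>These are the vectors H^i u1 with -p \<le> i < q, so that multiplication by
  \<open>H\<close> or \<open>Hi\<close> shifts a contiguous range of exponents.\<close>

definition kry_gens :: "nat \<Rightarrow> nat \<Rightarrow> real vec set" where
  "kry_gens p q = {(H ^\<^sub>m k) *\<^sub>v u1 | k. k < q} \<union> {(Hi ^\<^sub>m k) *\<^sub>v (Hi *\<^sub>v u1) | k. k < p}"

lemma pow_vec [simp]: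
  "w \<in> carrier_vec (2*n) \<Longrightarrow> (H ^\<^sub>m k) *\<^sub>v w \<in> carrier_vec (2*n)"
  "w \<in> carrier_vec (2*n) \<Longrightarrow> (Hi ^\<^sub>m k) *\<^sub>v w \<in> carrier_vec (2*n)"
  using mult_mat_vec_carrier[OF pow_carrier_mat[OF H_carrier]]
    mult_mat_vec_carrier[OF pow_carrier_mat[OF Hi_carrier]] by auto

lemma kry_gens_carrier: "kry_gens p q \<subseteq> carrier_vec (2*n)"
  unfolding kry_gens_def by auto

lemma span_kry_gens:
  "span (kry_gens p q) = sum_of_subspaces (krylov q H u1) (krylov p Hi (Hi *\<^sub>v u1))"
  unfolding kry_gens_def krylov_def by (rule subspace_sum_span[symmetric]) auto

lemma span_kry_gens_mono:
  "\<lbrakk>w \<in> span (kry_gens p q); p \<le> p'; q \<le> q'\<rbrakk> \<Longrightarrow> w \<in> span (kry_gens p' q')"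
  by (erule span_mono) (auto simp: kry_gens_def intro: less_le_trans)

text \<open>Every exponent rises by one. The exponent -1 becomes 0, which is in the new range even
  for \<open>q = 0\<close>.\<close>

lemma span_kry_gens_H:
  assumes "w \<in> span (kry_gens p q)"
  shows "H *\<^sub>v w \<in> span (kry_gens p (Suc q))"
proof (rule span_mult_mat_vec[OF assms kry_gens_carrier H_carrier kry_gens_carrier])
  fix c assume "c \<in> kry_gens p q"
  then consider k where "k < q" "c = (H ^\<^sub>m k) *\<^sub>v u1"
    | k where "k < p" "c = (Hi ^\<^sub>m k) *\<^sub>v (Hi *\<^sub>v u1)"
    unfolding kry_gens_def by blast
  then have "H *\<^sub>v c \<in> kry_gens p (Suc q)"
  proof cases
    case (1 k)
    then have "H *\<^sub>v c = (H ^\<^sub>m Suc k) *\<^sub>v u1"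
      by (simp add: pow_mat_Suc_vec[OF H_carrier] del: pow_mat.simps)
    with 1 show ?thesis
      unfolding kry_gens_def by blast
  next
    case (2 k)
    show ?thesis
    proof (cases k)
      case 0
      with 2 Hi_carrier H_carrier have "H *\<^sub>v c = (H ^\<^sub>m 0) *\<^sub>v u1"
        by simp
      then show ?thesis
        unfolding kry_gens_def by blast
    next
      case (Suc l)
      with 2 have "H *\<^sub>v c = (Hi ^\<^sub>m l) *\<^sub>v (Hi *\<^sub>v u1)" "l < p"
        by (simp_all add: pow_mat_Suc_vec[OF Hi_carrier] del: pow_mat.simps)
      then show ?thesis
        unfolding kry_gens_def by blast
    qed
  qed
  then show "H *\<^sub>v c \<in> span (kry_gens p (Suc q))"
    using kry_gens_carrier by (rule span_base)
qed

text \<open>Every exponent drops by one. The exponent 0 becomes -1, which is in the new range even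
  for \<open>p = 0\<close>.\<close>

lemma span_kry_gens_Hi:
  assumes "w \<in> span (kry_gens p q)"
  shows "Hi *\<^sub>v w \<in> span (kry_gens (Suc p) q)"
proof (rule span_mult_mat_vec[OF assms kry_gens_carrier Hi_carrier kry_gens_carrier])
  fix c assume "c \<in> kry_gens p q"
  then consider k where "k < q" "c = (H ^\<^sub>m k) *\<^sub>v u1"
    | k where "k < p" "c = (Hi ^\<^sub>m k) *\<^sub>v (Hi *\<^sub>v u1)"
    unfolding kry_gens_def by blast
  then have "Hi *\<^sub>v c \<in> kry_gens (Suc p) q"
  proof cases
    case (2 k)
    then have "Hi *\<^sub>v c = (Hi ^\<^sub>m Suc k) *\<^sub>v (Hi *\<^sub>v u1)"
      by (simp add: pow_mat_Suc_vec[OF Hi_carrier] del: pow_mat.simps)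
    with 2 show ?thesis
      unfolding kry_gens_def by blast
  next
    case (1 k)
    show ?thesis
    proof (cases k)
      case 0
      with 1 Hi_carrier H_carrier have "Hi *\<^sub>v c = (Hi ^\<^sub>m 0) *\<^sub>v (Hi *\<^sub>v u1)"
        by simp
      then show ?thesis
        unfolding kry_gens_def by blast
    next
      case (Suc l)
      with 1 have "Hi *\<^sub>v c = (H ^\<^sub>m l) *\<^sub>v u1" "l < q"
        by (simp_all add: pow_mat_Suc_vec[OF H_carrier] del: pow_mat.simps)
      then show ?thesis
        unfolding kry_gens_def by blast
    qed
  qed
  then show "Hi *\<^sub>v c \<in> span (kry_gens (Suc p) q)"
    using kry_gens_carrier by (rule span_base)
qed

subsection \<open>The invariant of the procedure\<close>

text \<open>
  In \<open>Hi_recurrence\<close> the truncated subtraction is intended: \<open>e = 1\<close> gives \<open>a (e - 2) = a 0 = u1\<close>,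
  which is the vector used in step (2).
\<close>
definition heks_invariant :: "nat \<Rightarrow> (nat \<Rightarrow> real vec) \<Rightarrow> (nat \<Rightarrow> real vec) \<Rightarrow> bool" where
  "heks_invariant m a b \<longleftrightarrow>
     m \<ge> 1 \<and> J_orthonormal m a b \<and> a 0 = u1 \<and>
     (\<forall>t<m. \<exists>d. d \<noteq> 0 \<and> H *\<^sub>v a t = d \<cdot>\<^sub>v b t) \<and>
     (\<forall>e<m. even e \<longrightarrow> (\<forall>s<e. H *\<^sub>v b s \<in> span (insert (a e) (pairs e a b)))) \<and>
     (\<forall>e<m. odd e \<longrightarrow> (\<forall>s<e. Hi *\<^sub>v a s \<in> span (insert (b e) (pairs e a b)))) \<and>
     (\<forall>e<m. even e \<longrightarrow> e \<noteq> 0 \<longrightarrow>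
        a e \<in> span (insert (H *\<^sub>v b (e - 2)) (pairs e a b))) \<and>
     (\<forall>e<m. odd e \<longrightarrow> b e \<in> span (insert (Hi *\<^sub>v a (e - 2)) (pairs e a b))) \<and>
     pairs m a b \<subseteq> span (kry_gens (2 * (m div 2)) (2 * (Suc m div 2)))"

lemma heks_invariantD:
  assumes "heks_invariant m a b"
  shows heks_invariant_pos: "m \<ge> 1"
    and heks_invariant_J: "J_orthonormal m a b"
    and heks_invariant_0: "a 0 = u1"
    and H_a: "t < m \<Longrightarrow> \<exists>d. d \<noteq> 0 \<and> H *\<^sub>v a t = d \<cdot>\<^sub>v b t"
    and H_b: "\<lbrakk>e < m; even e; s < e\<rbrakk> \<Longrightarrow> H *\<^sub>v b s \<in> span (insert (a e) (pairs e a b))"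
    and Hi_a: "\<lbrakk>e < m; odd e; s < e\<rbrakk> \<Longrightarrow> Hi *\<^sub>v a s \<in> span (insert (b e) (pairs e a b))"
    and H_recurrence: "\<lbrakk>e < m; even e; e \<noteq> 0\<rbrakk> \<Longrightarrow>
      a e \<in> span (insert (H *\<^sub>v b (e - 2)) (pairs e a b))"
    and Hi_recurrence: "\<lbrakk>e < m; odd e\<rbrakk> \<Longrightarrow>
      b e \<in> span (insert (Hi *\<^sub>v a (e - 2)) (pairs e a b))"
    and pairs_kry: "pairs m a b \<subseteq> span (kry_gens (2 * (m div 2)) (2 * (Suc m div 2)))"
  using assms unfolding heks_invariant_def by blast+

section \<open>Consequences of the invariant and its preservation\<close>

lemma heks_invariant_carrier:
  assumes "heks_invariant m a b" "t < m"
  shows "a t \<in> carrier_vec (2*n)" "b t \<in> carrier_vec (2*n)"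
  using assms J_orthonormalD(1,2)[OF heks_invariant_J] by blast+

text \<open>Inverts the relation between \<open>a t\<close> and \<open>b t\<close>; this rests on
  \<open>d \<noteq> 0\<close> in the invariant.\<close>

lemma Hi_b:
  assumes inv: "heks_invariant m a b" and t: "t < m"
  shows "\<exists>d. Hi *\<^sub>v b t = d \<cdot>\<^sub>v a t"
proof -
  obtain d where d: "d \<noteq> 0" "H *\<^sub>v a t = d \<cdot>\<^sub>v b t"
    using H_a[OF assms] by blast
  note c = heks_invariant_carrier[OF inv t]
  have "a t = Hi *\<^sub>v (d \<cdot>\<^sub>v b t)"
    using c by (simp flip: d(2))
  also have "\<dots> = d \<cdot>\<^sub>v (Hi *\<^sub>v b t)"
    using c by (simp add: mult_mat_vec[OF Hi_carrier])
  finally have "Hi *\<^sub>v b t = (1/d) \<cdot>\<^sub>v a t"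
    using d(1) c by (simp add: smult_smult_assoc)
  then show ?thesis ..
qed

text \<open>The invariant for \<open>m\<close> reads only ages below \<open>m\<close>, so the next
  pair may be written at index \<open>m\<close>.\<close>

lemma heks_invariant_cong:
  assumes inv: "heks_invariant m a b" and eq: "\<And>t. t < m \<Longrightarrow> a' t = a t" "\<And>t. t < m \<Longrightarrow> b' t = b t"
  shows "heks_invariant m a' b'"
proof -
  have "pairs e a' b' = pairs e a b" if "e \<le> m" for e
    unfolding pairs_def using eq that by (auto simp: image_def)
  then show ?thesis
    using inv eq unfolding heks_invariant_def J_orthonormal_def by simp
qed

text \<open>Adds a \<open>u\<close>, \<open>v\<close> pair. Once \<open>H\<close> maps every older
  \<open>b s\<close> into the span of \<open>a m\<close> and the older columns, skew-adjointness
  makes \<open>H *\<^sub>v a m\<close> orthogonal to all older columns, so the second projection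
  leaves it unchanged.\<close>

lemma heks_invariant_step_uv:
  assumes inv: "heks_invariant m a b" and m: "even m"
    and p: "J_projection m a b (H *\<^sub>v b (m - 2)) p" and am: "a m = c \<cdot>\<^sub>v p" and c: "c \<noteq> 0"
    and q: "J_projection m a b (H *\<^sub>v a m) q" and bm: "b m = c' \<cdot>\<^sub>v q" and c': "c' \<noteq> 0"
    and 1: "\<omega> (a m) (b m) = 1"
  shows "heks_invariant (Suc m) a b"
proof -
  let ?X = "pairs m a b"
  have m2: "m \<ge> 2"
    using heks_invariant_pos[OF inv] m by (cases "m = 1") auto
  note J = heks_invariant_J[OF inv]
  note X = pairs_carrier[OF J]
  have am_carrier: "a m \<in> carrier_vec (2*n)" and bm_carrier: "b m \<in> carrier_vec (2*n)"
    using J_projectionD(1)[OF p] J_projectionD(1)[OF q] unfolding am bm by auto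
  have oa: "\<omega> z (a m) = 0" and ob: "\<omega> z (b m) = 0" if "z \<in> ?X" for z
    using J_projectionD(1)[OF p] J_projectionD(1)[OF q] J_projectionD(4)[OF p that]
      J_projectionD(4)[OF q that] that X[OF order_refl]
    unfolding am bm by (auto simp: Jform_smult_right subset_iff)
  have sp_a: "span (insert (a m) ?X) = span (insert p ?X)"
    unfolding am by (rule span_smult_cancel) (use c X J_projectionD(1)[OF p] in auto)
  have Xa: "insert (a m) ?X \<subseteq> carrier_vec (2*n)"
    using X am_carrier by auto
  have in_Xa: "z \<in> span (insert (a m) ?X)" if "z \<in> ?X" for z
    using that Xa by (auto intro: span_base)
  have R0: "H *\<^sub>v b (m - 2) \<in> span (insert (a m) ?X)"
    unfolding sp_a by (rule J_projectionD(2)[OF p])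
  have R1: "a m \<in> span (insert (H *\<^sub>v b (m - 2)) ?X)"
    unfolding am
    by (rule smult_in_span) (use J_projectionD(3)[OF p] m2 X heks_invariant_carrier[OF inv] in auto)
  \<comment> \<open>The index \<open>m - 2\<close> is the recurrence just obtained; smaller indices
    are covered by the invariant at the even age \<open>m - 2\<close>.\<close>
  have Q1: "H *\<^sub>v b s \<in> span (insert (a m) ?X)" if "s < m - 1" for s
  proof (cases "s = m - 2")
    case False
    have "H *\<^sub>v b s \<in> span (insert (a (m - 2)) (pairs (m - 2) a b))"
      using False that m m2 by (intro H_b[OF inv]) auto
    then show ?thesis
      by (rule span_mono) (use m2 pairs_mono[of "m - 2" m a b] in \<open>auto intro: pairsI\<close>)
  qed (use R0 in simp)
  have Q: "H *\<^sub>v b s \<in> span (insert (a m) ?X)" if "s < m" for s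
  proof (cases "s = m - 1")
    case True
    \<comment> \<open>The age \<open>m - 1\<close> is odd, so \<open>b (m - 1)\<close> has a
      recurrence through \<open>Hi\<close>. There \<open>H\<close> cancels the inverse in the
      leading vector, sends each \<open>a s\<close> to a multiple of \<open>b s\<close>, and the
      remaining \<open>b s\<close> are covered by \<open>Q1\<close>. For \<open>m = 2\<close> the
      truncated \<open>m - 1 - 2\<close> is 0, as the recurrence requires.\<close>
    have "H *\<^sub>v b (m - 1) \<in> span (insert (a m) ?X)"
    proof (rule span_mult_mat_vec[OF _ _ H_carrier Xa])
      show "b (m - 1) \<in> span (insert (Hi *\<^sub>v a (m - 1 - 2)) (pairs (m - 1) a b))"
        using m m2 by (intro Hi_recurrence[OF inv]) auto
      show "insert (Hi *\<^sub>v a (m - 1 - 2)) (pairs (m - 1) a b) \<subseteq> carrier_vec (2*n)"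
        using X[of "m - 1"] m2 heks_invariant_carrier(1)[OF inv] by auto
      fix z assume "z \<in> insert (Hi *\<^sub>v a (m - 1 - 2)) (pairs (m - 1) a b)"
      then consider "z = Hi *\<^sub>v a (m - 1 - 2)" | s where "z = a s" "s < m - 1"
        | s where "z = b s" "s < m - 1"
        unfolding pairs_def by auto
      then show "H *\<^sub>v z \<in> span (insert (a m) ?X)"
      proof cases
        case 1
        then show ?thesis
          using m2 heks_invariant_carrier(1)[OF inv] by (auto intro!: in_Xa pairsI)
      next
        case (2 s)
        then have "s < m"
          by simp
        with 2 obtain d where d: "H *\<^sub>v z = d \<cdot>\<^sub>v b s"
          using H_a[OF inv] by blast
        show ?thesis
          unfolding d by (intro smult_in_span[OF Xa] in_Xa pairsI) fact
      qed (use Q1 in auto)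
    qed
    with True show ?thesis
      by simp
  qed (use Q1 that in auto)
  \<comment> \<open>Move \<open>H\<close> to the left: \<open>H *\<^sub>v z\<close> is a multiple of
    an older \<open>b s\<close> or lies in the span of \<open>a m\<close> and the older columns, and
    all of these are orthogonal to \<open>a m\<close>.\<close>
  have "\<omega> z (H *\<^sub>v a m) = 0" if z: "z \<in> ?X" for z
  proof -
    consider s where "z = a s" "s < m" | s where "z = b s" "s < m"
      using z unfolding pairs_def by auto
    then have "\<omega> (H *\<^sub>v z) (a m) = 0"
    proof cases
      case (1 s)
      then obtain d where "H *\<^sub>v z = d \<cdot>\<^sub>v b s"
        using H_a[OF inv, of s] by auto
      then show ?thesis
        using 1 am_carrier heks_invariant_carrier[OF inv, of s] oa[OF pairsI(2)]
        by (simp add: Jform_smult_left)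
    next
      case (2 s)
      show ?thesis
        unfolding 2(1) by (rule Jform_span[OF Q[OF 2(2)] Xa am_carrier])
          (use oa Jform_self am_carrier in auto)
    qed
    then show ?thesis
      using Jform_H_left[of z "a m"] z X am_carrier by auto
  qed
  then have qH: "q = H *\<^sub>v a m"
    by (rule J_projectionD(5)[OF q])
  have "H *\<^sub>v a m = (1/c') \<cdot>\<^sub>v b m"
    unfolding bm qH using c' am_carrier by (simp add: smult_smult_assoc)
  moreover have "1/c' \<noteq> 0"
    using c' by simp
  ultimately have Ham: "\<exists>d. d \<noteq> 0 \<and> H *\<^sub>v a m = d \<cdot>\<^sub>v b m"
    by blast
  have J': "J_orthonormal (Suc m) a b"
    by (rule J_orthonormal_Suc[OF J am_carrier bm_carrier oa ob 1])
  \<comment> \<open>The two multiplications by \<open>H\<close> add the exponents \<open>2*k\<close>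
    and \<open>2*k + 1\<close>.\<close>
  obtain k where k: "m = 2*k" using m by blast
  have X_kry: "?X \<subseteq> span (kry_gens (2*k) (2*k))"
    using pairs_kry[OF inv] unfolding k by simp
  have "H *\<^sub>v b (m - 2) \<in> span (kry_gens (2*k) (Suc (2*k)))"
    by (intro span_kry_gens_H subsetD[OF X_kry] pairsI) (use m2 in simp)
  moreover have "?X \<subseteq> span (kry_gens (2*k) (Suc (2*k)))"
    using X_kry span_kry_gens_mono[of _ "2*k" "2*k" "2*k" "Suc (2*k)"] by auto
  ultimately have a_kry: "a m \<in> span (kry_gens (2*k) (Suc (2*k)))"
    by (intro span_mono_span[OF R1 _ kry_gens_carrier]) auto
  have b_kry: "b m \<in> span (kry_gens (2*k) (Suc (Suc (2*k))))"
    unfolding bm qH by (intro smult_in_span[OF kry_gens_carrier] span_kry_gens_H a_kry)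
  have "pairs (Suc m) a b \<subseteq> span (kry_gens (2*k) (Suc (Suc (2*k))))"
    unfolding pairs_Suc using a_kry b_kry X_kry
      span_kry_gens_mono[of _ "2*k" _ "2*k" "Suc (Suc (2*k))"] by auto
  then have K: "pairs (Suc m) a b
      \<subseteq> span (kry_gens (2 * (Suc m div 2)) (2 * (Suc (Suc m) div 2)))"
    unfolding k by simp
  show ?thesis
    unfolding heks_invariant_def
    using J' K inv m R1 Q Ham unfolding heks_invariant_def less_Suc_eq by auto
qed

text \<open>The mirror image for an \<open>x\<close>, \<open>y\<close> pair: \<open>Hi\<close>
  replaces \<open>H\<close>, the roles of \<open>a\<close> and \<open>b\<close> are exchanged, and
  \<open>b m\<close> is created first. The case \<open>m = 1\<close> is included, where
  \<open>m - 2\<close> is 0.\<close>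

lemma heks_invariant_step_xy:
  assumes inv: "heks_invariant m a b" and m: "odd m"
    and p: "J_projection m a b (Hi *\<^sub>v a (m - 2)) p" and bm: "b m = c \<cdot>\<^sub>v p" and c: "c \<noteq> 0"
    and q: "J_projection m a b (Hi *\<^sub>v b m) q" and am: "a m = c' \<cdot>\<^sub>v q" and c': "c' \<noteq> 0"
    and 1: "\<omega> (a m) (b m) = 1"
  shows "heks_invariant (Suc m) a b"
proof -
  let ?X = "pairs m a b"
  have m1: "m \<ge> 1"
    by (rule heks_invariant_pos[OF inv])
  note J = heks_invariant_J[OF inv]
  note X = pairs_carrier[OF J]
  have am_carrier: "a m \<in> carrier_vec (2*n)" and bm_carrier: "b m \<in> carrier_vec (2*n)"
    using J_projectionD(1)[OF p] J_projectionD(1)[OF q] unfolding am bm by auto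
  have oa: "\<omega> z (a m) = 0" and ob: "\<omega> z (b m) = 0" if "z \<in> ?X" for z
    using J_projectionD(1)[OF p] J_projectionD(1)[OF q] J_projectionD(4)[OF p that]
      J_projectionD(4)[OF q that] that X[OF order_refl]
    unfolding am bm by (auto simp: Jform_smult_right subset_iff)
  have sp_b: "span (insert (b m) ?X) = span (insert p ?X)"
    unfolding bm by (rule span_smult_cancel) (use c X J_projectionD(1)[OF p] in auto)
  have Xb: "insert (b m) ?X \<subseteq> carrier_vec (2*n)"
    using X bm_carrier by auto
  have in_Xb: "z \<in> span (insert (b m) ?X)" if "z \<in> ?X" for z
    using that Xb by (auto intro: span_base)
  have R0: "Hi *\<^sub>v a (m - 2) \<in> span (insert (b m) ?X)"
    unfolding sp_b by (rule J_projectionD(2)[OF p])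
  have R1: "b m \<in> span (insert (Hi *\<^sub>v a (m - 2)) ?X)"
    unfolding bm
    by (rule smult_in_span) (use J_projectionD(3)[OF p] m1 X heks_invariant_carrier[OF inv] in auto)
  \<comment> \<open>The bound is not \<open>s < m - 1\<close> because for \<open>m = 1\<close> the
    truncated \<open>m - 2\<close> is 0, and \<open>R0\<close> settles this only index.\<close>
  have Q1: "Hi *\<^sub>v a s \<in> span (insert (b m) ?X)" if "s \<le> m - 2" for s
  proof (cases "s = m - 2")
    case False
    have "Hi *\<^sub>v a s \<in> span (insert (b (m - 2)) (pairs (m - 2) a b))"
      using False that m m1 by (intro Hi_a[OF inv]) auto
    then show ?thesis
      by (rule span_mono) (use m1 pairs_mono[of "m - 2" m a b] in \<open>auto intro: pairsI\<close>)
  qed (use R0 in simp)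
  have Q: "Hi *\<^sub>v a s \<in> span (insert (b m) ?X)" if "s < m" for s
  proof (cases "s \<le> m - 2")
    case False
    \<comment> \<open>Only \<open>m \<ge> 3\<close> is left, so \<open>m - 1\<close> is a positive
      even age and \<open>a (m - 1)\<close> has a recurrence through \<open>H\<close>.\<close>
    with that have s: "s = m - 1" "m - 1 \<noteq> 0"
      by auto
    have "Hi *\<^sub>v a (m - 1) \<in> span (insert (b m) ?X)"
    proof (rule span_mult_mat_vec[OF _ _ Hi_carrier Xb])
      show "a (m - 1) \<in> span (insert (H *\<^sub>v b (m - 1 - 2)) (pairs (m - 1) a b))"
        using m m1 s by (intro H_recurrence[OF inv]) auto
      show "insert (H *\<^sub>v b (m - 1 - 2)) (pairs (m - 1) a b) \<subseteq> carrier_vec (2*n)"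
        using X[of "m - 1"] m1 heks_invariant_carrier(2)[OF inv] by auto
      fix z assume "z \<in> insert (H *\<^sub>v b (m - 1 - 2)) (pairs (m - 1) a b)"
      then consider "z = H *\<^sub>v b (m - 1 - 2)" | s where "z = a s" "s < m - 1"
        | s where "z = b s" "s < m - 1"
        unfolding pairs_def by auto
      then show "Hi *\<^sub>v z \<in> span (insert (b m) ?X)"
      proof cases
        case 1
        then show ?thesis
          using m1 heks_invariant_carrier(2)[OF inv] by (auto intro!: in_Xb pairsI)
      next
        case (3 s)
        then have "s < m"
          by simp
        with 3 obtain d where d: "Hi *\<^sub>v z = d \<cdot>\<^sub>v a s"
          using Hi_b[OF inv] by blast
        show ?thesis
          unfolding d by (intro smult_in_span[OF Xb] in_Xb pairsI) fact
      qed (use Q1 in auto)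
    qed
    with s show ?thesis
      by simp
  qed (use Q1 in auto)
  have "\<omega> z (Hi *\<^sub>v b m) = 0" if z: "z \<in> ?X" for z
  proof -
    consider s where "z = a s" "s < m" | s where "z = b s" "s < m"
      using z unfolding pairs_def by auto
    then have "\<omega> (Hi *\<^sub>v z) (b m) = 0"
    proof cases
      case (2 s)
      then obtain d where "Hi *\<^sub>v z = d \<cdot>\<^sub>v a s"
        using Hi_b[OF inv, of s] by auto
      then show ?thesis
        using 2 bm_carrier heks_invariant_carrier[OF inv, of s] ob[OF pairsI(1)]
        by (simp add: Jform_smult_left)
    next
      case (1 s)
      show ?thesis
        unfolding 1(1) by (rule Jform_span[OF Q[OF 1(2)] Xb bm_carrier])
          (use ob Jform_self bm_carrier in auto)
    qed
    then show ?thesis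
      using Jform_Hi_left[of z "b m"] z X bm_carrier by auto
  qed
  then have qHi: "q = Hi *\<^sub>v b m"
    by (rule J_projectionD(5)[OF q])
  have Ham: "H *\<^sub>v a m = c' \<cdot>\<^sub>v b m"
    unfolding am qHi using bm_carrier by (simp add: mult_mat_vec[OF H_carrier])
  have J': "J_orthonormal (Suc m) a b"
    by (rule J_orthonormal_Suc[OF J am_carrier bm_carrier oa ob 1])
  obtain k where k: "m = 2*k + 1" using m by (rule oddE)
  have X_kry: "?X \<subseteq> span (kry_gens (2*k) (2*k + 2))"
    using pairs_kry[OF inv] unfolding k by simp
  have "Hi *\<^sub>v a (m - 2) \<in> span (kry_gens (Suc (2*k)) (2*k + 2))"
    by (intro span_kry_gens_Hi subsetD[OF X_kry] pairsI) (use m1 in simp)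
  moreover have "?X \<subseteq> span (kry_gens (Suc (2*k)) (2*k + 2))"
    using X_kry span_kry_gens_mono[of _ "2*k" "2*k + 2" "Suc (2*k)" "2*k + 2"] by auto
  ultimately have b_kry: "b m \<in> span (kry_gens (Suc (2*k)) (2*k + 2))"
    by (intro span_mono_span[OF R1 _ kry_gens_carrier]) auto
  have a_kry: "a m \<in> span (kry_gens (Suc (Suc (2*k))) (2*k + 2))"
    unfolding am qHi by (intro smult_in_span[OF kry_gens_carrier] span_kry_gens_Hi b_kry)
  have "pairs (Suc m) a b \<subseteq> span (kry_gens (Suc (Suc (2*k))) (2*k + 2))"
    unfolding pairs_Suc using a_kry b_kry X_kry
      span_kry_gens_mono[of _ _ "2*k + 2" "Suc (Suc (2*k))" "2*k + 2"] by auto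
  then have K: "pairs (Suc m) a b
      \<subseteq> span (kry_gens (2 * (Suc m div 2)) (2 * (Suc (Suc m) div 2)))"
    unfolding k by simp
  show ?thesis
    unfolding heks_invariant_def
    using J' K inv m R1 Q Ham c' unfolding heks_invariant_def less_Suc_eq by auto
qed

subsection \<open>From the lists of columns to the invariant\<close>

definition heks_cols :: "nat \<Rightarrow> (nat \<Rightarrow> real vec) \<Rightarrow> (nat \<Rightarrow> real vec) \<Rightarrow> real vec list" where
  "heks_cols m a b =
     map (\<lambda>i. a (col_age (m div 2) i)) [0..<m] @ map (\<lambda>i. b (col_age (m div 2) i)) [0..<m]"

lemma length_heks_cols [simp]: "length (heks_cols m a b) = 2*m"
  by (simp add: heks_cols_def)

lemma heks_cols_nth:
  "i < m \<Longrightarrow> heks_cols m a b ! i = a (col_age (m div 2) i)"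
  "i < m \<Longrightarrow> heks_cols m a b ! (m + i) = b (col_age (m div 2) i)"
  "i < m \<Longrightarrow> heks_cols m a b ! (i + m) = b (col_age (m div 2) i)"
  by (simp_all add: heks_cols_def nth_append)

lemma set_heks_cols: "set (heks_cols m a b) = pairs m a b"
proof -
  have "set (heks_cols m a b)
      = a ` col_age (m div 2) ` {..<m} \<union> b ` col_age (m div 2) ` {..<m}"
    unfolding heks_cols_def by (simp add: image_image lessThan_atLeast0)
  then show ?thesis
    unfolding pairs_def col_age_image .
qed

text \<open>Since \<open>col_age\<close> is injective, the ages at two positions agree exactly when
  the positions do.\<close>

lemma heks_cols_J:
  assumes J: "J_orthonormal m a b"
  defines "S \<equiv> mat_of_cols (2*n) (heks_cols m a b)"
  shows "S\<^sup>T * Jmat n * S = Jmat m"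
proof (rule eq_matI)
  have S: "S \<in> carrier_mat (2*n) (2*m)"
    unfolding S_def by (metis length_heks_cols mat_of_cols_carrier(1))
  then show "dim_row (S\<^sup>T * Jmat n * S) = dim_row (Jmat m)"
    "dim_col (S\<^sup>T * Jmat n * S) = dim_col (Jmat m)"
    by auto
  fix i j assume "i < dim_row (Jmat m)" "j < dim_col (Jmat m)"
  then have ij: "i < 2*m" "j < 2*m"
    by auto
  have col: "col S h = heks_cols m a b ! h" if "h < 2*m" for h
    unfolding S_def using that pairs_carrier[OF J order_refl] set_heks_cols[of m a b]
    by (intro col_mat_of_cols) (auto simp: subset_iff)
  have half: "h < m \<or> (\<exists>h'<m. h = m + h')" if "h < 2*m" for h
    using that by presburger
  have "(S\<^sup>T * Jmat n * S) $$ (i, j) = \<omega> (heks_cols m a b ! i) (heks_cols m a b ! j)"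
    unfolding Gram_index[OF S Jmat_carrier ij] Jform_def using ij by (simp add: col)
  also have "\<dots> = Jmat m $$ (i, j)"
    using half[OF ij(1)] half[OF ij(2)] ij
    by (auto simp: heks_cols_nth index_Jmat J_orthonormalD[OF J] col_age_less col_age_inj)
  finally show "(S\<^sup>T * Jmat n * S) $$ (i, j) = Jmat m $$ (i, j)" .
qed

text \<open>With \<open>z = J\<^sup>T S\<^sup>T J w\<close> the projected vector is
  \<open>w - S z\<close>, and \<open>S z\<close> lies in the span of the columns; this gives both
  span memberships. If \<open>w\<close> is orthogonal to all columns, then
  \<open>z = 0\<close>.\<close>

lemma J_projection_J_proj:
  assumes J: "J_orthonormal m a b" and w: "w \<in> carrier_vec (2*n)"
  shows "J_projection m a b w (J_proj n m (mat_of_cols (2*n) (heks_cols m a b)) *\<^sub>v w)"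
proof -
  define S where "S = mat_of_cols (2*n) (heks_cols m a b)"
  let ?X = "pairs m a b"
  define G where "G = S\<^sup>T * Jmat n"
  define z where "z = (Jmat m)\<^sup>T *\<^sub>v (G *\<^sub>v w)"
  have X: "?X \<subseteq> carrier_vec (2*n)"
    by (rule pairs_carrier[OF J order_refl])
  have S: "S \<in> carrier_mat (2*n) (2*m)"
    unfolding S_def by (metis length_heks_cols mat_of_cols_carrier(1))
  have G: "G \<in> carrier_mat (2*m) (2*n)"
    unfolding G_def using S by auto
  have Jt: "(Jmat m)\<^sup>T \<in> carrier_mat (2*m) (2*m)"
    by simp
  have JG: "(Jmat m)\<^sup>T * G \<in> carrier_mat (2*m) (2*n)"
    by (rule mult_carrier_mat[OF Jt G])
  have P: "J_proj n m S = 1\<^sub>m (2*n) - S * ((Jmat m)\<^sup>T * G)"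
  proof -
    have "S * (Jmat m)\<^sup>T * S\<^sup>T * Jmat n = S * (Jmat m)\<^sup>T * G"
      unfolding G_def by (rule assoc_mult_mat) (use S in auto)
    also have "\<dots> = S * ((Jmat m)\<^sup>T * G)"
      by (rule assoc_mult_mat[OF S Jt G])
    finally show ?thesis
      unfolding J_proj_def by simp
  qed
  define p where "p = J_proj n m S *\<^sub>v w"
  have z: "z \<in> carrier_vec (2*m)"
    unfolding z_def using G Jt w by (intro mult_mat_vec_carrier) auto
  have Sz_carrier: "S *\<^sub>v z \<in> carrier_vec (2*n)"
    by (rule mult_mat_vec_carrier[OF S z])
  have p: "p = w - S *\<^sub>v z"
    unfolding p_def P z_def using S G Jt JG w
    by (simp add: minus_mult_distrib_mat_vec[of _ "2*n" "2*n"] assoc_mult_mat_vec[OF S JG]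
        assoc_mult_mat_vec[OF Jt G])
  have p_carrier: "p \<in> carrier_vec (2*n)"
    unfolding p using Sz_carrier w by simp
  have cols: "set (cols S) = ?X"
    using X set_heks_cols[of m a b] unfolding S_def by (subst cols_mat_of_cols) auto
  have Sz: "S *\<^sub>v z \<in> span ?X"
    using col_space_eq[OF S] z Sz_carrier S unfolding col_space_def cols by auto
  have minus_Sz: "- (S *\<^sub>v z) \<in> span ?X"
  proof -
    have "- (S *\<^sub>v z) = (-1) \<cdot>\<^sub>v (S *\<^sub>v z)"
      by (intro eq_vecI) auto
    then show ?thesis
      using smult_in_span[OF X Sz, of "-1"] by argo
  qed
  have spanI: "c \<in> span (insert v ?X)" if "c \<in> span ?X" for c v
    using that by (rule span_mono) auto
  have self: "v \<in> span (insert v ?X)" if "v \<in> carrier_vec (2*n)" for v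
    using that X by (intro span_base) auto
  have "w = p + S *\<^sub>v z"
    unfolding p using w Sz_carrier S by (intro eq_vecI) auto
  also have "\<dots> \<in> span (insert p ?X)"
    by (rule span_add1) (use p_carrier X self Sz in \<open>auto intro: spanI\<close>)
  finally have 1: "w \<in> span (insert p ?X)" .
  have "p = w + - (S *\<^sub>v z)"
    unfolding p using w Sz_carrier S by (intro eq_vecI) auto
  also have "\<dots> \<in> span (insert w ?X)"
    by (rule span_add1) (use w X self minus_Sz in \<open>auto intro: spanI\<close>)
  finally have 2: "p \<in> span (insert w ?X)" .
  have G_nth: "(G *\<^sub>v v) $ i = \<omega> (col S i) v" if "i < 2*m" "v \<in> carrier_vec (2*n)" for i v
  proof -
    have "G *\<^sub>v v = S\<^sup>T *\<^sub>v (Jmat n *\<^sub>v v)"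
      unfolding G_def using S that by (intro assoc_mult_mat_vec) auto
    then show ?thesis
      using that S by (simp add: Jform_def)
  qed
  \<comment> \<open>Here \<open>G P = G - (G S) J\<^sup>T G\<close> with \<open>G S = J\<close> and
    \<open>J J\<^sup>T = 1\<close>, so the projected vector is orthogonal to every column.\<close>
  have "G * J_proj n m S = G * 1\<^sub>m (2*n) - G * (S * ((Jmat m)\<^sup>T * G))"
    unfolding P by (rule mult_minus_distrib_mat[OF G]) (use S JG in auto)
  also have "G * (S * ((Jmat m)\<^sup>T * G)) = G * S * ((Jmat m)\<^sup>T * G)"
    by (rule assoc_mult_mat[symmetric, OF G S JG])
  also have "G * S = Jmat m"
    unfolding G_def S_def by (rule heks_cols_J[OF J])
  also have "Jmat m * ((Jmat m)\<^sup>T * G) = Jmat m * (Jmat m)\<^sup>T * G"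
    by (rule assoc_mult_mat[symmetric, OF Jmat_carrier Jt G])
  finally have "G * J_proj n m S = 0\<^sub>m (2*m) (2*n)"
    using G by (simp add: Jmat_inverse)
  then have "G *\<^sub>v p = 0\<^sub>v (2*m)"
    unfolding p_def using G w S JG
    by (subst assoc_mult_mat_vec[OF G, symmetric]) (auto simp: P)
  then have "\<omega> (col S i) p = 0" if "i < 2*m" for i
    using G_nth[OF that p_carrier] that by simp
  then have 3: "\<omega> c p = 0" if "c \<in> ?X" for c
    using that S unfolding cols[symmetric] by (auto simp: cols_def)
  have 4: "p = w" if orth: "\<And>c. c \<in> ?X \<Longrightarrow> \<omega> c w = 0"
  proof -
    have "G *\<^sub>v w = 0\<^sub>v (2*m)"
    proof (rule eq_vecI)
      fix i assume "i < dim_vec (0\<^sub>v (2*m) :: real vec)"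
      then have i: "i < 2*m"
        by simp
      then have "col S i \<in> ?X"
        unfolding cols[symmetric] using S by (auto simp: cols_def)
      then show "(G *\<^sub>v w) $ i = 0\<^sub>v (2*m) $ i"
        using G_nth[OF i w] orth i by simp
    qed (use G in auto)
    then have "z = (Jmat m)\<^sup>T *\<^sub>v 0\<^sub>v (2*m)"
      unfolding z_def by simp
    also have "\<dots> = 0\<^sub>v (2*m)"
      by (intro eq_vecI) auto
    finally have "S *\<^sub>v z = 0\<^sub>v (2*n)"
      using S by (intro eq_vecI) auto
    then show ?thesis
      unfolding p using w by simp
  qed
  show ?thesis
    unfolding J_projection_def p_def[symmetric] S_def[symmetric]
    using p_carrier 1 2 3 4 by blast
qed

text \<open>The vectors y_j and x_j have age \<open>2*j - 1\<close>, and u_j and v_j have age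
  \<open>2*j - 2\<close>. Hence \<open>ys\<close> and \<open>xs\<close> run through the odd ages
  downwards, \<open>us\<close> and \<open>ws\<close> through the even ages upwards.\<close>

definition heks_lists ::
  "nat \<Rightarrow> (nat \<Rightarrow> real vec) \<Rightarrow> (nat \<Rightarrow> real vec) \<Rightarrow>
   real vec list \<Rightarrow> real vec list \<Rightarrow> real vec list \<Rightarrow> real vec list \<Rightarrow> bool" where
  "heks_lists m a b ys us xs ws \<longleftrightarrow>
     ys = map (\<lambda>i. a (2 * (m div 2 - i) - 1)) [0..<m div 2] \<and>
     us = map (\<lambda>i. a (2*i)) [0..<Suc m div 2] \<and>
     xs = map (\<lambda>i. b (2 * (m div 2 - i) - 1)) [0..<m div 2] \<and>
     ws = map (\<lambda>i. b (2*i)) [0..<Suc m div 2]"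

lemma map_col_age:
  "map (\<lambda>i. c (2 * (m div 2 - i) - 1)) [0..<m div 2] @ map (\<lambda>i. c (2*i)) [0..<Suc m div 2]
    = map (\<lambda>i. c (col_age (m div 2) i)) [0..<m]"
  by (rule nth_equalityI) (auto simp: nth_append col_age_def)

lemma heks_mat_eq:
  "heks_lists m a b ys us xs ws \<Longrightarrow> heks_mat n ys us xs ws = mat_of_cols (2*n) (heks_cols m a b)"
  unfolding heks_mat_def heks_lists_def heks_cols_def
  by (simp flip: map_col_age append_assoc)

lemma heks_lists_uv:
  assumes "heks_lists (2*k) a b ys us xs ws"
  shows "heks_lists (Suc (2*k)) (a(2*k := u)) (b(2*k := v)) ys (us @ [u]) xs (ws @ [v])"
  using assms unfolding heks_lists_def by auto

lemma heks_lists_xy: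
  assumes "heks_lists (Suc (2*k)) a b ys us xs ws"
  shows "heks_lists (Suc (Suc (2*k))) (a(Suc (2*k) := y)) (b(Suc (2*k) := x)) (y # ys) us (x # xs) ws"
proof -
  have new: "map (\<lambda>i. (c(Suc (2*k) := z)) (2 * (Suc k - i) - 1)) [0..<Suc k]
      = z # map (\<lambda>i. c (2 * (k - i) - 1)) [0..<k]" for c :: "nat \<Rightarrow> real vec" and z
    by (rule nth_equalityI) (auto simp: nth_Cons nth_append less_Suc_eq_0_disj simp del: upt_Suc)
  \<comment> \<open>The updated age is odd, so the lists over even ages do not change.\<close>
  have "2*i \<noteq> Suc (2*k)" for i
    by presburger
  then have old: "map (\<lambda>i. (c(Suc (2*k) := z)) (2*i)) [0..<Suc k] = map (\<lambda>i. c (2*i)) [0..<Suc k]"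
    for c :: "nat \<Rightarrow> real vec" and z
    by simp
  have k: "Suc (Suc (2*k)) div 2 = Suc k" "Suc (2*k) div 2 = k" "Suc (Suc (Suc (2*k))) div 2 = Suc k"
    by simp_all
  show ?thesis
    using assms unfolding heks_lists_def k new old by blast
qed

section \<open>Extending the sequences by one pair\<close>

lemma heks_invariant_extend_uv:
  assumes inv: "heks_invariant m a b" and m: "even m"
    and wu: "wu = J_proj n m (mat_of_cols (2*n) (heks_cols m a b)) *\<^sub>v (H *\<^sub>v b (m - 2))"
    and u: "u = (1 / norm2 wu) \<cdot>\<^sub>v wu" and nu: "norm2 wu \<noteq> 0"
    and wv: "wv = J_proj n m (mat_of_cols (2*n) (heks_cols m a b)) *\<^sub>v (H *\<^sub>v u)"
    and v: "v = (1 / \<omega> u wv) \<cdot>\<^sub>v wv" and nv: "\<omega> u wv \<noteq> 0"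
  shows "heks_invariant (Suc m) (a(m := u)) (b(m := v))"
proof -
  let ?a = "a(m := u)" and ?b = "b(m := v)"
  have m2: "m - 2 < m"
    using heks_invariant_pos[OF inv] by simp
  have inv': "heks_invariant m ?a ?b"
    by (rule heks_invariant_cong[OF inv]) auto
  \<comment> \<open>All ages in the current matrix are below \<open>m\<close>, so writing the new
    pair at \<open>m\<close> does not alter the projection.\<close>
  have "col_age (m div 2) i \<noteq> m" if "i < m" for i
    using col_age_less[OF that] by simp
  then have cols: "heks_cols m ?a ?b = heks_cols m a b"
    unfolding heks_cols_def by auto
  note J = heks_invariant_J[OF inv']
  have p: "J_projection m ?a ?b (H *\<^sub>v ?b (m - 2)) wu"
    using J_projection_J_proj[OF J, of "H *\<^sub>v ?b (m - 2)"] heks_invariant_carrier(2)[OF inv' m2]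
      m2 unfolding cols wu by simp
  have u_carrier: "u \<in> carrier_vec (2*n)"
    unfolding u using J_projectionD(1)[OF p] by simp
  have q: "J_projection m ?a ?b (H *\<^sub>v ?a m) wv"
    using J_projection_J_proj[OF J, of "H *\<^sub>v u"] u_carrier unfolding cols wv by simp
  have 1: "\<omega> (?a m) (?b m) = 1"
    using nv J_projectionD(1)[OF q] u_carrier unfolding v by (simp add: Jform_smult_right)
  show ?thesis
    by (rule heks_invariant_step_uv[OF inv' m p _ _ q _ _ 1, of "1 / norm2 wu" "1 / \<omega> u wv"])
      (use u v nu nv in simp_all)
qed

lemma heks_invariant_extend_xy:
  assumes inv: "heks_invariant m a b" and m: "odd m"
    and wx: "wx = J_proj n m (mat_of_cols (2*n) (heks_cols m a b)) *\<^sub>v (Hi *\<^sub>v a (m - 2))"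
    and x: "x = (1 / norm2 wx) \<cdot>\<^sub>v wx" and nx: "norm2 wx \<noteq> 0"
    and wy: "wy = J_proj n m (mat_of_cols (2*n) (heks_cols m a b)) *\<^sub>v (Hi *\<^sub>v x)"
    and y: "y = (1 / \<omega> wy x) \<cdot>\<^sub>v wy" and ny: "\<omega> wy x \<noteq> 0"
  shows "heks_invariant (Suc m) (a(m := y)) (b(m := x))"
proof -
  let ?a = "a(m := y)" and ?b = "b(m := x)"
  have m2: "m - 2 < m"
    using heks_invariant_pos[OF inv] by simp
  have inv': "heks_invariant m ?a ?b"
    by (rule heks_invariant_cong[OF inv]) auto
  have "col_age (m div 2) i \<noteq> m" if "i < m" for i
    using col_age_less[OF that] by simp
  then have cols: "heks_cols m ?a ?b = heks_cols m a b"
    unfolding heks_cols_def by auto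
  note J = heks_invariant_J[OF inv']
  have p: "J_projection m ?a ?b (Hi *\<^sub>v ?a (m - 2)) wx"
    using J_projection_J_proj[OF J, of "Hi *\<^sub>v ?a (m - 2)"] heks_invariant_carrier(1)[OF inv' m2]
      m2 unfolding cols wx by simp
  have x_carrier: "x \<in> carrier_vec (2*n)"
    unfolding x using J_projectionD(1)[OF p] by simp
  have q: "J_projection m ?a ?b (Hi *\<^sub>v ?b m) wy"
    using J_projection_J_proj[OF J, of "Hi *\<^sub>v x"] x_carrier unfolding cols wy by simp
  have 1: "\<omega> (?a m) (?b m) = 1"
    using ny J_projectionD(1)[OF q] x_carrier unfolding y by (simp add: Jform_smult_left)
  show ?thesis
    by (rule heks_invariant_step_xy[OF inv' m p _ _ q _ _ 1, of "1 / norm2 wx" "1 / \<omega> wy x"])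
      (use x y nx ny in simp_all)
qed

text \<open>Passes from the lists of the procedure to sequences indexed by age; every rule after the
  first updates the sequences at the next age.\<close>

lemma heks_sequence:
  assumes "heks n H u1 m ys us xs ws"
  shows "\<exists>a b. heks_invariant m a b \<and> heks_lists m a b ys us xs ws"
  using assms
proof (induction rule: heks.induct)
  case (start d v1)
  \<comment> \<open>For \<open>m = 1\<close> only age 0 is read, so constant sequences
    serve.\<close>
  let ?a = "\<lambda>_::nat. u1" and ?b = "\<lambda>_::nat. v1"
  have v1: "v1 \<in> carrier_vec (2*n)"
    unfolding start(3) by simp
  have uv: "\<omega> u1 v1 = 1"
    unfolding start(3) using start(1,2) by (simp add: Jform_smult_right)
  have J: "J_orthonormal (Suc 0) ?a ?b"
    unfolding J_orthonormal_def using v1 uv by (simp add: Jform_self)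
  have Hu: "H *\<^sub>v u1 = d \<cdot>\<^sub>v v1"
    unfolding start(3) using start(2) by (simp add: smult_smult_assoc)
  have "(H ^\<^sub>m 0) *\<^sub>v u1 \<in> kry_gens 0 1"
    unfolding kry_gens_def by blast
  then have "u1 \<in> span (kry_gens 0 1)"
    using H_carrier span_base[OF _ kry_gens_carrier] by simp
  then have "v1 \<in> span (kry_gens 0 2)" "u1 \<in> span (kry_gens 0 2)"
    unfolding start(3) using smult_in_span[OF kry_gens_carrier] span_kry_gens_H[of u1 0 1]
      span_kry_gens_mono[of u1 0 1 0 2] by (auto simp: numeral_2_eq_2)
  then have K: "pairs (Suc 0) ?a ?b \<subseteq> span (kry_gens 0 2)"
    unfolding pairs_def by auto
  have "heks_invariant 1 ?a ?b"
    unfolding heks_invariant_def using J K Hu start(2) by (auto simp: eval_nat_numeral)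
  moreover have "heks_lists 1 ?a ?b [] [u1] [] [v1]"
    unfolding heks_lists_def by simp
  ultimately show ?case
    by blast
next
  case (first_xy us ws P wx x wy y)
  then obtain a b where inv: "heks_invariant 1 a b" and lists: "heks_lists 1 a b [] us [] ws"
    by blast
  have "heks_invariant (Suc 1) (a(1 := y)) (b(1 := x))"
  proof (rule heks_invariant_extend_xy[OF inv])
    show "wx = J_proj n 1 (mat_of_cols (2*n) (heks_cols 1 a b)) *\<^sub>v (Hi *\<^sub>v a (1 - 2))"
      using first_xy heks_mat_eq[OF lists] heks_invariant_0[OF inv] by simp
    show "wy = J_proj n 1 (mat_of_cols (2*n) (heks_cols 1 a b)) *\<^sub>v (Hi *\<^sub>v x)"
      using first_xy heks_mat_eq[OF lists] by simp
  qed (use first_xy in simp_all)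
  with heks_lists_xy[of 0 a b _ us _ ws y x] lists show ?case
    by (auto simp: numeral_2_eq_2)
next
  case (next_uv k ys us xs ws P wu u wv v)
  then obtain a b where inv: "heks_invariant (2*k) a b" and lists: "heks_lists (2*k) a b ys us xs ws"
    by blast
  \<comment> \<open>The last entry of \<open>ws\<close> is v_k, of age
    \<open>2*k - 2\<close>.\<close>
  have last: "last ws = b (2*k - 2)"
    using lists next_uv.hyps(2) unfolding heks_lists_def by (simp add: last_map diff_mult_distrib2)
  have "heks_invariant (Suc (2*k)) (a(2*k := u)) (b(2*k := v))"
  proof (rule heks_invariant_extend_uv[OF inv])
    show "wu = J_proj n (2*k) (mat_of_cols (2*n) (heks_cols (2*k) a b)) *\<^sub>v (H *\<^sub>v b (2*k - 2))"
      using next_uv heks_mat_eq[OF lists] last by simp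
    show "wv = J_proj n (2*k) (mat_of_cols (2*n) (heks_cols (2*k) a b)) *\<^sub>v (H *\<^sub>v u)"
      using next_uv heks_mat_eq[OF lists] by simp
  qed (use next_uv in simp_all)
  with heks_lists_uv[OF lists, of u v] show ?case
    by auto
next
  case (next_xy k ys us xs ws P wx x wy y)
  then obtain a b where inv: "heks_invariant (Suc (2*k)) a b"
    and lists: "heks_lists (Suc (2*k)) a b ys us xs ws"
    by auto
  \<comment> \<open>The first entry of \<open>ys\<close> is y_k, of age
    \<open>2*k - 1\<close>.\<close>
  have hd: "hd ys = a (Suc (2*k) - 2)"
    using lists next_xy.hyps(2) unfolding heks_lists_def by (simp add: hd_map upt_conv_Cons)
  have "heks_invariant (Suc (Suc (2*k))) (a(Suc (2*k) := y)) (b(Suc (2*k) := x))"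
  proof (rule heks_invariant_extend_xy[OF inv])
    show "wx = J_proj n (Suc (2*k)) (mat_of_cols (2*n) (heks_cols (Suc (2*k)) a b))
        *\<^sub>v (Hi *\<^sub>v a (Suc (2*k) - 2))"
      using next_xy heks_mat_eq[OF lists] hd by simp
    show "wy = J_proj n (Suc (2*k)) (mat_of_cols (2*n) (heks_cols (Suc (2*k)) a b)) *\<^sub>v (Hi *\<^sub>v x)"
      using next_xy heks_mat_eq[OF lists] by simp
  qed (use next_xy in simp_all)
  with heks_lists_xy[OF lists, of y x] show ?case
    by (auto simp: numeral_2_eq_2)
qed

text \<open>\<open>H *\<^sub>v b s\<close> lies in the span of \<open>a e\<close> and the pairs
  older than \<open>e\<close>. All these ages are below \<open>t\<close>, so \<open>b t\<close> is
  orthogonal to that span, and skew-adjointness moves \<open>H\<close> to the other side.\<close>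

lemma Jform_b_H_b_zero:
  assumes inv: "heks_invariant m a b" and e: "even e" "s < e" "e < t" and t: "t < m"
  shows "\<omega> (b s) (H *\<^sub>v b t) = 0"
proof -
  note J = heks_invariant_J[OF inv]
  note carrier = heks_invariant_carrier[OF inv]
  have "\<omega> (H *\<^sub>v b s) (b t) = 0"
  proof (rule Jform_span)
    show "H *\<^sub>v b s \<in> span (insert (a e) (pairs e a b))"
      using e t by (intro H_b[OF inv]) auto
    show "insert (a e) (pairs e a b) \<subseteq> carrier_vec (2*n)"
      using carrier(1)[of e] pairs_carrier[OF J, of e] e t by auto
    show "\<omega> c (b t) = 0" if "c \<in> insert (a e) (pairs e a b)" for c
      using that e t J_orthonormalD(4,5)[OF J] unfolding pairs_def by auto
  qed (use carrier t in auto)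
  then show ?thesis
    using Jform_H_left[of "b s" "b t"] carrier e t by simp
qed

end

subsection \<open>The symplectic matrix\<close>

text \<open>From \<open>S\<^sup>T J S = J\<close> and \<open>J\<^sup>T J = 1\<close> comes a left
  inverse, which for square matrices is two-sided and unique.\<close>

lemma symplectic_inverse:
  assumes S: "symplectic n S"
  shows "minv S = (Jmat n)\<^sup>T * (S\<^sup>T * Jmat n)" and "invertible_mat S"
proof -
  let ?R = "(Jmat n)\<^sup>T * (S\<^sup>T * Jmat n)"
  have S_carrier: "S \<in> carrier_mat (2*n) (2*n)" and SJS: "S\<^sup>T * Jmat n * S = Jmat n"
    using S unfolding symplectic_def by auto
  have Jt: "(Jmat n)\<^sup>T \<in> carrier_mat (2*n) (2*n)"
    by simp
  have SJ: "S\<^sup>T * Jmat n \<in> carrier_mat (2*n) (2*n)"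
    by (rule mult_carrier_mat[of _ _ "2*n"]) (use S_carrier in auto)
  have R: "?R \<in> carrier_mat (2*n) (2*n)"
    by (rule mult_carrier_mat[OF Jt SJ])
  have RS: "?R * S = 1\<^sub>m (2*n)"
    unfolding assoc_mult_mat[OF Jt SJ S_carrier] SJS by (rule Jmat_inverse)
  then have SR: "S * ?R = 1\<^sub>m (2*n)"
    by (rule mat_mult_left_right_inverse[OF R S_carrier])
  show inv: "invertible_mat S"
    unfolding invertible_mat_def inverts_mat_def square_mat.simps
    using RS SR S_carrier R by (metis carrier_matD)
  note minv = minv_inverse[OF S_carrier inv]
  have "minv S = minv S * (S * ?R)"
    unfolding SR using minv(1) by simp
  also have "\<dots> = minv S * S * ?R"
    by (rule assoc_mult_mat[symmetric, OF minv(1) S_carrier R])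
  also have "\<dots> = ?R"
    unfolding minv(3) using R by simp
  finally show "minv S = ?R" .
qed

text \<open>The leading \<open>J\<^sup>T\<close> of the inverse swaps the halves of
  \<open>S\<^sup>T J H S\<close>, so the upper rows come from the columns \<open>n + i\<close> with
  a minus sign.\<close>

lemma symplectic_similarity_index:
  assumes S: "symplectic n S" and H: "H \<in> carrier_mat (2*n) (2*n)" and i: "i < n" and j: "j < 2*n"
  shows "(minv S * H * S) $$ (i, j) = - Jform n (col S (n + i)) (H *\<^sub>v col S j)"
    and "(minv S * H * S) $$ (n + i, j) = Jform n (col S i) (H *\<^sub>v col S j)"
proof -
  have S_carrier: "S \<in> carrier_mat (2*n) (2*n)"
    using S unfolding symplectic_def by auto
  let ?K = "Jmat n * H"
  let ?M = "S\<^sup>T * ?K * S"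
  have Jt: "(Jmat n)\<^sup>T \<in> carrier_mat (2*n) (2*n)" and St: "S\<^sup>T \<in> carrier_mat (2*n) (2*n)"
    using S_carrier by simp_all
  have SJ: "S\<^sup>T * Jmat n \<in> carrier_mat (2*n) (2*n)"
    by (rule mult_carrier_mat[OF St Jmat_carrier])
  have K: "?K \<in> carrier_mat (2*n) (2*n)"
    by (rule mult_carrier_mat[OF Jmat_carrier H])
  have SK: "S\<^sup>T * ?K \<in> carrier_mat (2*n) (2*n)"
    by (rule mult_carrier_mat[OF St K])
  have M: "?M \<in> carrier_mat (2*n) (2*n)"
    by (rule mult_carrier_mat[OF SK S_carrier])
  have eq: "minv S * H * S = (Jmat n)\<^sup>T * ?M"
    unfolding symplectic_inverse(1)[OF S] assoc_mult_mat[OF Jt SJ H]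
      assoc_mult_mat[OF St Jmat_carrier H] assoc_mult_mat[OF Jt SK S_carrier] ..
  have M_index: "?M $$ (i, j) = Jform n (col S i) (H *\<^sub>v col S j)" if "i < 2*n" for i
    unfolding Gram_index[OF S_carrier K that j] Jform_def
    by (subst assoc_mult_mat_vec[OF Jmat_carrier H]) (use S_carrier j in auto)
  show "(minv S * H * S) $$ (i, j) = - Jform n (col S (n + i)) (H *\<^sub>v col S j)"
    "(minv S * H * S) $$ (n + i, j) = Jform n (col S i) (H *\<^sub>v col S j)"
    unfolding eq Jmat_transpose_mult_index[OF M i j] using i by (simp_all add: M_index)
qed

text \<open>Reduces the range identity to a single inclusion.\<close>

lemma (in vec_space) col_space_invertible:
  assumes S: "S \<in> carrier_mat n n" and inv: "R \<in> carrier_mat n n" "S * R = 1\<^sub>m n"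
  shows "col_space S = carrier_vec n"
proof -
  have "S *\<^sub>v (R *\<^sub>v w) = w" if "w \<in> carrier_vec n" for w
    using that by (simp flip: assoc_mult_mat_vec[OF S inv(1)] add: inv(2))
  moreover have "R *\<^sub>v w \<in> carrier_vec n" if "w \<in> carrier_vec n" for w
    using that by (rule mult_mat_vec_carrier[OF inv(1)])
  ultimately show ?thesis
    unfolding col_space_eq[OF S] using S by (auto intro: bexI)
qed

theorem theorem4p1:
  fixes n r s :: nat and H :: "real mat" and u1 :: "real vec"
  assumes "hamiltonian n H" and "invertible_mat H"
    and "r \<ge> 1" and "r + s = n" and "r = s + 1 \<or> r = s"
    and "u1 \<in> carrier_vec (2*n)" and "norm2 u1 = 1"
    and "vec_space.subspace_dim (2*n) (vec_space.krylov (2*n) (2*r) H u1) = 2*r"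
    and "vec_space.subspace_dim (2*n)
           (vec_space.krylov (2*n) (2*s) (minv H) (minv H *\<^sub>v u1)) = 2*s"
    and "heks_no_breakdown n H u1 (r + s)"
  shows "\<exists>S. symplectic n S \<and>
    S *\<^sub>v unit_vec (2*n) s = u1 \<and>
    vec_space.col_space (2*n) S =
      vec_space.sum_of_subspaces (2*n)
        (vec_space.krylov (2*n) (2*r) H u1)
        (vec_space.krylov (2*n) (2*s) (minv H) (minv H *\<^sub>v u1)) \<and>
    (let y = (\<lambda>j. col S (s - j));
         u = (\<lambda>j. col S (s + j - 1));
         x = (\<lambda>j. col S (n + s - j));
         v = (\<lambda>j. col S (n + s + j - 1));
         \<delta> = (\<lambda>j. Jform n (y j) (H *\<^sub>v y j));
         lam = (\<lambda>j. - Jform n (x j) (H *\<^sub>v x j));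
         \<gamma> = (\<lambda>j. - Jform n (x j) (H *\<^sub>v v j));
         \<theta> = (\<lambda>j. Jform n (u j) (H *\<^sub>v u j));
         \<alpha> = (\<lambda>j. - Jform n (v j) (H *\<^sub>v v j));
         \<beta> = (\<lambda>j. - Jform n (v j) (H *\<^sub>v v (j - 1)));
         \<mu> = (\<lambda>j. - Jform n (x (j - 1)) (H *\<^sub>v v j));
         B = anti_bidiag s r \<gamma> \<mu>
     in minv S * H * S =
          four_block_mat
            (0\<^sub>m n n)
            (four_block_mat (diag_desc s lam) B B\<^sup>T (sym_tridiag r \<alpha> \<beta>))
            (four_block_mat (diag_desc s \<delta>) (0\<^sub>m s r) (0\<^sub>m r s) (diag_asc r \<theta>))
            (0\<^sub>m n n))"
proof -
  interpret heks_process n H u1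
    by unfold_locales (use assms in auto)
  \<comment> \<open>The alternatives for \<open>r\<close> make \<open>s\<close> and \<open>r\<close>
    the floor and the ceiling of \<open>n/2\<close>, which are the numbers of \<open>y\<close>,
    \<open>x\<close> pairs and of \<open>u\<close>, \<open>v\<close> pairs in the last
    matrix.\<close>
  have ns: "n = s + r" "n div 2 = s" "Suc n div 2 = r"
    using assms(4,5) by auto
  obtain ys us xs ws where "heks n H u1 n ys us xs ws"
    using assms(4,10) unfolding heks_no_breakdown_def by auto
  then obtain a b where inv: "heks_invariant n a b"
    using heks_sequence by blast
  note J = heks_invariant_J[OF inv]
  note carrier = heks_invariant_carrier[OF inv]
  define S where "S = mat_of_cols (2*n) (heks_cols n a b)"
  have S: "S \<in> carrier_mat (2*n) (2*n)"
    unfolding S_def by (metis length_heks_cols mat_of_cols_carrier(1))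
  have sympl: "symplectic n S"
    unfolding symplectic_def using S heks_cols_J[OF J] unfolding S_def by blast
  have X: "pairs n a b \<subseteq> carrier_vec (2*n)"
    by (rule pairs_carrier[OF J order_refl])
  have col: "col S i = heks_cols n a b ! i" if "i < 2*n" for i
    unfolding S_def using that X set_heks_cols[of n a b]
    by (intro col_mat_of_cols) (auto simp: subset_iff)
  have age: "col_age s i < n" if "i < n" for i
    using col_age_less[OF that] ns by simp
  have col_a: "col S i = a (col_age s i)" and col_b: "col S (n + i) = b (col_age s i)" if "i < n" for i
    using that by (simp_all add: col heks_cols_nth ns(2))
  have col_carrier: "col S i \<in> carrier_vec (2*n)" if "i < 2*n" for i
    by (rule col_carrier_vec[OF _ S]) (use that in simp)
  \<comment> \<open>These three facts hold because \<open>H\<close> sends \<open>a t\<close> to a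
    multiple of \<open>b t\<close>, together with the symmetry of
    \<open>\<omega> a (H *\<^sub>v b)\<close>. They make the lower left block diagonal and the two
    diagonal blocks zero.\<close>
  have aHa: "\<omega> (a s) (H *\<^sub>v a t) = 0" if "s < n" "t < n" "s \<noteq> t" for s t
    using H_a[OF inv that(2)] carrier that J_orthonormalD(5)[OF J that(1,2)]
    by (auto simp: Jform_smult_right)
  have bHa: "\<omega> (b s) (H *\<^sub>v a t) = 0" if "s < n" "t < n" for s t
    using H_a[OF inv that(2)] carrier that J_orthonormalD(4)[OF J that(1,2)]
    by (auto simp: Jform_smult_right)
  have aHb: "\<omega> (a s) (H *\<^sub>v b t) = 0" if "s < n" "t < n" for s t
    using bHa[OF that(2,1)] Jform_H_commute[of "a s" "b t"] carrier that by simp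

  \<comment> \<open>The minus sign in \<open>f\<close> is the one that \<open>J\<^sup>T\<close>
    brings to the upper rows; \<open>g\<close> serves the lower rows.\<close>
  define f where "f i j = - \<omega> (col S i) (H *\<^sub>v col S j)" for i j
  define g where "g i j = \<omega> (col S i) (H *\<^sub>v col S j)" for i j
  let ?B = "anti_bidiag s r (\<lambda>j. f (n + s - j) (n + s + j - 1)) (\<lambda>j. f (n + s - (j - 1)) (n + s + j - 1))"
  let ?U = "four_block_mat (diag_desc s (\<lambda>j. f (n + s - j) (n + s - j))) ?B ?B\<^sup>T
    (sym_tridiag r (\<lambda>j. f (n + s + j - 1) (n + s + j - 1)) (\<lambda>j. f (n + s + j - 1) (n + s + (j - 1) - 1)))"
  let ?D = "four_block_mat (diag_desc s (\<lambda>j. g (s - j) (s - j))) (0\<^sub>m s r) (0\<^sub>m r s)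
    (diag_asc r (\<lambda>j. g (s + j - 1) (s + j - 1)))"
  have U: "?U $$ (i, j) = f (n + i) (n + j)" if "i < n" "j < n" for i j
  proof (rule heks_block_mat[OF _ _ assms(5)])
    show "f (n + i) (n + j) = f (n + j) (n + i)" if "i < s + r" "j < s + r" for i j
      unfolding f_def
      using Jform_H_commute[OF col_carrier[of "n + i"] col_carrier[of "n + j"]] that ns(1) by simp
    show "f (n + i) (n + j) = 0"
      if "i < s + r" "j < s + r" "even e" "col_age s i < e" "e < col_age s j" for i j e
    proof -
      have "i < n" "j < n"
        using that(1,2) ns(1) by simp_all
      then show ?thesis
        unfolding f_def using Jform_b_H_b_zero[OF inv that(3-5) age] by (simp add: col_b)
    qed
  qed (use that ns in auto)
  have D: "?D $$ (i, j) = g i j" if "i < n" "j < n" for i j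
  proof (rule heks_diag_block_mat)
    show "g i j = 0" if "i < s + r" "j < s + r" "i \<noteq> j" for i j
    proof -
      have "i < n" "j < n"
        using that(1,2) ns(1) by simp_all
      then show ?thesis
        unfolding g_def using aHa[OF age age] that(3) by (simp add: col_a col_age_inj)
    qed
  qed (use that ns in auto)
  have dims: "dim_row ?U = n" "dim_col ?U = n" "dim_row ?D = n" "dim_col ?D = n"
    using ns by (simp_all add: diag_desc_def diag_asc_def sym_tridiag_def mat1_def)
  have minv_S: "minv S \<in> carrier_mat (2*n) (2*n)" "S * minv S = 1\<^sub>m (2*n)"
    using minv_inverse[OF S symplectic_inverse(2)[OF sympl]] by blast+
  have main: "minv S * H * S = four_block_mat (0\<^sub>m n n) ?U ?D (0\<^sub>m n n)"
  proof (rule eq_matI)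
    show "dim_row (minv S * H * S) = dim_row (four_block_mat (0\<^sub>m n n) ?U ?D (0\<^sub>m n n))"
      "dim_col (minv S * H * S) = dim_col (four_block_mat (0\<^sub>m n n) ?U ?D (0\<^sub>m n n))"
      using S minv_S by simp_all
    fix i j
    assume "i < dim_row (four_block_mat (0\<^sub>m n n) ?U ?D (0\<^sub>m n n))"
      "j < dim_col (four_block_mat (0\<^sub>m n n) ?U ?D (0\<^sub>m n n))"
    then have ij: "i < n + n" "j < n + n"
      by simp_all
    note index = symplectic_similarity_index[OF sympl H_carrier]
    have half: "h < n \<or> (\<exists>h'<n. h = n + h')" if "h < n + n" for h
      by (cases "h < n") (use that in \<open>auto intro!: exI[of _ "h - n"]\<close>)
    consider "i < n" "j < n" | j' where "i < n" "j = n + j'" "j' < n"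
      | i' where "i = n + i'" "i' < n" "j < n" | i' j' where "i = n + i'" "i' < n" "j = n + j'" "j' < n"
      using half[OF ij(1)] half[OF ij(2)] by blast
    then show "(minv S * H * S) $$ (i, j) = four_block_mat (0\<^sub>m n n) ?U ?D (0\<^sub>m n n) $$ (i, j)"
    proof cases
      case 1
      then show ?thesis
        using index(1)[of i j] bHa[OF age age] ij dims by (simp add: col_a col_b)
    next
      case (2 j')
      have "four_block_mat (0\<^sub>m n n) ?U ?D (0\<^sub>m n n) $$ (i, j) = ?U $$ (i, j')"
        using 2 ij by (subst index_mat_four_block) simp_all
      then show ?thesis
        using index(1)[of i j] 2 U[of i j'] unfolding f_def by simp
    next
      case (3 i')
      have "four_block_mat (0\<^sub>m n n) ?U ?D (0\<^sub>m n n) $$ (i, j) = ?D $$ (i', j)"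
        using 3 ij dims by (subst index_mat_four_block) simp_all
      then show ?thesis
        using index(2)[of i' j] 3 D[of i' j] unfolding g_def by simp
    next
      case (4 i' j')
      then show ?thesis
        using index(2)[of i' j] aHb[OF age age] ij dims by (simp add: col_a col_b)
    qed
  qed

  have "s < n"
    using ns assms(3) by simp
  \<comment> \<open>The zero-based position \<open>s\<close> has age 0, and \<open>a 0\<close> is
    \<open>u1\<close>.\<close>
  have "S *\<^sub>v unit_vec (2*n) s = col S s"
    by (rule eq_vecI) (use S \<open>s < n\<close> in auto)
  also have "\<dots> = u1"
    using col_a[OF \<open>s < n\<close>] heks_invariant_0[OF inv] by (simp add: col_age_def)
  finally have "S *\<^sub>v unit_vec (2*n) s = u1" .
  moreover have "col_space S = sum_of_subspaces (krylov (2*r) H u1) (krylov (2*s) (minv H) (minv H *\<^sub>v u1))"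
  proof -
    have K: "pairs n a b \<subseteq> span (kry_gens (2*s) (2*r))"
      using pairs_kry[OF inv] unfolding ns(2,3) .
    have "col_space S = span (pairs n a b)"
      unfolding col_space_def S_def using X set_heks_cols[of n a b] by (subst cols_mat_of_cols) auto
    also have "\<dots> \<subseteq> span (kry_gens (2*s) (2*r))"
      by (rule span_subsetI[OF kry_gens_carrier K])
    finally have "col_space S \<subseteq> span (kry_gens (2*s) (2*r))" .
    moreover have "span (kry_gens (2*s) (2*r)) \<subseteq> carrier_vec (2*n)"
      by (rule span_is_subset2[OF kry_gens_carrier])
    ultimately show ?thesis
      unfolding span_kry_gens[symmetric] col_space_invertible[OF S minv_S] by blast
  qed
  moreover note main
  ultimately show ?thesis
    using sympl unfolding Let_def f_def g_def by blast
qed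

end
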